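(* Let $D=K((G))$ be the Mal'cev--Neumann division ring described in the context, with center $F$, let $\alpha=x_1^{-1}+x_2^{-1}+\cdots\in D$, and let $D_\alpha:=F(\alpha,\sqrt{p_1},\sqrt{p_2},\ldots)$ be the division subring of $D$ generated by $F$, $\alpha$ and all the $\sqrt{p_i}$. Then $D_\alpha$ is a division ring which is not algebraic (over its center), and every non-central element of $D_\alpha$ is a Kurosh element of $D_\alpha$.
   Context: Let $G=\bigoplus_{i=1}^\infty\mathbb{Z}$ be the free abelian group of countably infinite rank, totally ordered lexicographically: $(n_1,n_2,\ldots)<(m_1,m_2,\ldots)$ iff there is $k\ge 1$ with $n_i=m_i$ for all $i<k$ and $n_k<m_k$. From now on $G$ is written multiplicatively, and $x_i\in G$ denotes the element with $1$ in position $i$ and $0$ elsewhere. Let $p_1<p_2<\cdots$ be an increasing infinite sequence of primes and $K=\mathbb{Q}(\sqrt{p_1},\sqrt{p_2},\ldots)\subseteq\mathbb{R}$. $G$ acts on $K$ by $\mathbb{Q}$-automorphisms $c\mapsto c^g$: for $g=(n_1,n_2,\ldots)$, $(\sqrt{p_i})^g=(-1)^{n_i}\sqrt{p_i}$ for all $i$. $D=K((G))$ is the set of formal sums $\alpha=\sum_{g\in G}\alpha_g g$ with $\alpha_g\in K$ and with support $\mathrm{supp}(\alpha)=\{g\in G:\alpha_g\neq 0\}$ well-ordered, with addition $\alpha+\beta=\sum_g(\alpha_g+\beta_g)g$ and multiplication $\alpha\cdot\beta=\sum_{g}\big(\sum_{uv=g}\alpha_u\beta_v^{u}\big)g$; it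 is a division ring. Since $x_i^{-1}<x_{i+1}^{-1}$ for all $i$, the formal sum $x_1^{-1}+x_2^{-1}+\cdots$ has well-ordered support. A division ring is algebraic if each of its elements is a root of some nonzero polynomial over its center, and centrally finite if it is a finite dimensional vector space over its center. A non-central element $x$ of a division ring $E$ is called Kurosh if there exists a centrally finite division subring $E_1$ of $E$ such that $x\in E_1$ and $x$ is not in the center of $E_1$. *)

theory Defs
  imports
    "HOL-Algebra.Algebraic_Closure_Type"
    "HOL-Algebra.Generated_Fields"
    "HOL-Library.Poly_Mapping"
    "HOL-Computational_Algebra.Primes"
begin

section \<open>Division rings\<close>

text \<open>HOL-Algebra only has the commutative locale \<^locale>\<open>field\<close>; this is its
  noncommutative counterpart.\<close>

locale skewfield = ring +
  assumes one_not_zero: "\<one> \<noteq> \<zero>"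
    and skewfield_Units: "Units R = carrier R - {\<zero>}"

definition center :: "('a, 'm) ring_scheme \<Rightarrow> 'a set" where
  "center R = {z \<in> carrier R. \<forall>x \<in> carrier R. z \<otimes>\<^bsub>R\<^esub> x = x \<otimes>\<^bsub>R\<^esub> z}"

definition division_subring :: "'a set \<Rightarrow> ('a, 'm) ring_scheme \<Rightarrow> bool" where
  "division_subring S R \<longleftrightarrow> subring S R \<and> skewfield (R\<lparr>carrier := S\<rparr>)"

definition generated_division_subring :: "('a, 'm) ring_scheme \<Rightarrow> 'a set \<Rightarrow> 'a set" where
  "generated_division_subring R A = (\<lambda>S. division_subring S R) hull A"

text \<open>\<open>ring.algebraic\<close> of HOL-Algebra is not used, since it is phrased as non-injectivity of
  evaluation. The zero polynomial is the empty list.\<close>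

definition algebraic_skewfield :: "('a, 'm) ring_scheme \<Rightarrow> bool" where
  "algebraic_skewfield E \<longleftrightarrow> skewfield E \<and>
     (\<forall>x \<in> carrier E. \<exists>f \<in> carrier (univ_poly E (center E)).
        f \<noteq> [] \<and> ring.eval E f x = \<zero>\<^bsub>E\<^esub>)"

definition centrally_finite :: "('a, 'm) ring_scheme \<Rightarrow> bool" where
  "centrally_finite E \<longleftrightarrow> skewfield E \<and> ring.finite_dimension E (center E) (carrier E)"

definition kurosh :: "('a, 'm) ring_scheme \<Rightarrow> 'a \<Rightarrow> bool" where
  "kurosh E x \<longleftrightarrow> x \<in> carrier E - center E \<and>
     (\<exists>E\<^sub>1. division_subring E\<^sub>1 E \<and> centrally_finite (E\<lparr>carrier := E\<^sub>1\<rparr>) \<and>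
           x \<in> E\<^sub>1 \<and> x \<notin> center (E\<lparr>carrier := E\<^sub>1\<rparr>))"


section \<open>The group and its action on the coefficient field\<close>

text \<open>The group is kept additive, so products \<open>u v\<close> become sums \<open>u + v\<close> and the generator
  \<open>x\<^sub>i\<close> is \<open>single i 1\<close>. Positions are numbered from \<open>0\<close>. The library order on finitely
  supported maps compares at the least position of disagreement, i.e. it is the
  lexicographic order.\<close>

type_synonym G = "nat \<Rightarrow>\<^sub>0 int"

definition K_set :: "(nat \<Rightarrow> nat) \<Rightarrow> real set" where
  "K_set p = generate_field ring_of_type_algebra (\<rat> \<union> range (\<lambda>i. sqrt (real (p i))))"

definition K_ring :: "(nat \<Rightarrow> nat) \<Rightarrow> real ring" where
  "K_ring p = ring_of_type_algebra\<lparr>carrier := K_set p\<rparr>"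

text \<open>Restricting to functions that are \<open>undefined\<close> off \<open>K_set p\<close> makes the
  automorphism unique as a HOL function. It exists because the square roots of
  distinct primes are independent modulo squares of rationals.\<close>

definition act :: "(nat \<Rightarrow> nat) \<Rightarrow> G \<Rightarrow> real \<Rightarrow> real" where
  "act p g = (THE \<sigma>. \<sigma> \<in> extensional (K_set p) \<and> \<sigma> \<in> ring_iso (K_ring p) (K_ring p) \<and>
      (\<forall>q \<in> \<rat>. \<sigma> q = q) \<and>
      (\<forall>i. \<sigma> (sqrt (real (p i))) = (-1) powi (Poly_Mapping.lookup g i) * sqrt (real (p i))))"


section \<open>The Mal'cev--Neumann division ring\<close>

definition supp :: "(G \<Rightarrow> real) \<Rightarrow> G set" where
  "supp a = {g. a g \<noteq> 0}"

definition const :: "real \<Rightarrow> G \<Rightarrow> real" where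
  "const c = (\<lambda>g. if g = 0 then c else 0)"

text \<open>The index set of the sum defining the product is finite for well-ordered supports.\<close>

definition D :: "(nat \<Rightarrow> nat) \<Rightarrow> (G \<Rightarrow> real) ring" where
  "D p = \<lparr>
     carrier = {a. range a \<subseteq> K_set p \<and>
       well_order_on (supp a) {(g, h). g \<in> supp a \<and> h \<in> supp a \<and> g \<le> h}},
     monoid.mult = (\<lambda>a b g. \<Sum>(u, v) | u \<in> supp a \<and> v \<in> supp b \<and> u + v = g. a u * act p u (b v)),
     one = const 1,
     ring.zero = (\<lambda>_. 0),
     add = (\<lambda>a b g. a g + b g)\<rparr>"

definition alpha :: "G \<Rightarrow> real" where
  "alpha = (\<lambda>g. if \<exists>i. g = - Poly_Mapping.single i 1 then 1 else 0)"

definition D_alpha :: "(nat \<Rightarrow> nat) \<Rightarrow> (G \<Rightarrow> real) ring" where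
  "D_alpha p = (D p)\<lparr>carrier := generated_division_subring (D p)
     (center (D p) \<union> {alpha} \<union> range (\<lambda>i. const (sqrt (real (p i)))))\<rparr>"

end

theory Submission
  imports Defs
begin

text \<open>
  In \<open>D\<close> write \<open>s\<^sub>i\<close> for the constant \<open>\<surd>p\<^sub>i\<close> and \<open>t\<^sub>i\<close> for \<open>x\<^sub>i\<^sup>-\<^sup>1\<close>. Then
  \<open>s\<^sub>i t\<^sub>i = - t\<^sub>i s\<^sub>i\<close>, and all other pairs among these elements commute. A series that commutes
  with every \<open>t\<^sub>i\<close> has coefficients fixed by the whole group, hence rational ones, and two such
  series commute with each other. A series that commutes with every \<open>s\<^sub>i\<close> as well is central. Finally
  \<open>\<alpha> s\<^sub>i = s\<^sub>i (\<alpha> - 2 t\<^sub>i)\<close>, so \<open>D\<^sub>\<alpha>\<close> contains all \<open>t\<^sub>i\<close>. The locale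
  \<open>quaternion_tower\<close> collects these facts about a division ring, and the theorem follows from
  them alone.

  \<^emph>\<open>\<open>D\<^sub>\<alpha>\<close> is not algebraic.\<close> A polynomial with central coefficients that vanishes at \<open>\<alpha>\<close>
  also vanishes at the conjugates \<open>s\<^sub>i\<^sup>-\<^sup>1 \<alpha> s\<^sub>i = \<alpha> - 2 t\<^sub>i\<close>. These are infinitely many elements
  of the centralizer of all \<open>t\<^sub>i\<close>, which is a field, so the polynomial is zero
  (\<open>alpha_transcendental\<close>).

  \<^emph>\<open>Non-central elements are Kurosh.\<close> Let \<open>E\<^sub>n\<close> consist of the elements of \<open>D\<^sub>\<alpha>\<close> that
  commute with \<open>t\<^sub>i\<close> for all \<open>i \<ge> n\<close>. As a centralizer it is a division subring. The \<open>E\<^sub>n\<close> increase,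
  and their union contains the center, \<open>\<alpha>\<close> and every \<open>s\<^sub>i\<close>, so it is \<open>D\<^sub>\<alpha>\<close>
  (\<open>\<Delta>_eq_Union_layer\<close>). For \<open>i < n\<close> both \<open>s\<^sub>i\<close> and \<open>t\<^sub>i\<close> lie in \<open>E\<^sub>n\<close>, and
  splitting into the \<open>\<plusminus>1\<close>-eigenspaces of conjugation by each such \<open>s\<^sub>i\<close> and \<open>t\<^sub>i\<close> writes each element
  of \<open>E\<^sub>n\<close> as a combination of \<open>4\<^sup>n\<close> monomials in these generators. The coefficients commute with all
  \<open>s\<^sub>i\<close>, \<open>t\<^sub>i\<close> with \<open>i < n\<close> and, being in \<open>E\<^sub>n\<close>, with all \<open>t\<^sub>i\<close>; so they commute with each other and
  form the center of \<open>E\<^sub>n\<close>, which is therefore centrally finite (\<open>centrally_finite_layer\<close>). A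
  non-central \<open>x\<close> fails to commute with some \<open>s\<^sub>i\<close> or \<open>t\<^sub>i\<close>, hence is a non-central element of
  \<open>E\<^sub>n\<close> as soon as \<open>n > i\<close> and \<open>x \<in> E\<^sub>n\<close>.

  It remains to see that \<open>D\<close> is a division ring with the stated properties. The action on \<open>K\<close>
  exists because \<open>\<surd>p\<^sub>n\<close> does not lie in \<open>\<rat>(\<surd>p\<^sub>0, \<dots>, \<surd>p\<^sub>n\<^sub>-\<^sub>1)\<close>, so the signs of the
  square roots can be chosen one at a time. Products are defined and associative because two well-ordered
  subsets of an ordered group have a well-ordered sum in which each element has finitely many
  representations. Inverses come from solving \<open>a y = 1\<close> coefficient by coefficient in increasing
  order of exponents: partial solutions are unique, so they form a chain, and their union is a
  solution since otherwise one more term could be appended (\<open>right_inverse_exists\<close>).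
\<close>

section \<open>Division subrings and centralizers\<close>

context skewfield
begin

lemma inv_props:
  assumes "x \<in> carrier R" "x \<noteq> \<zero>"
  shows "inv x \<in> carrier R" "x \<otimes> inv x = \<one>" "inv x \<otimes> x = \<one>"
  using assms skewfield_Units by (auto simp: Units_inv_closed Units_r_inv Units_l_inv)

lemma domain_property:
  assumes "x \<in> carrier R" "y \<in> carrier R" "x \<otimes> y = \<zero>" "x \<noteq> \<zero>"
  shows "y = \<zero>"
proof -
  have "y = inv x \<otimes> (x \<otimes> y)"
    using assms inv_props[of x] by (metis m_assoc l_one)
  thus ?thesis using assms inv_props[of x] by simp
qed

lemma inv_unique_left:
  assumes "x \<in> carrier R" "y \<in> carrier R" "y \<otimes> x = \<one>"
  shows "inv x = y"
proof -
  have nz: "x \<noteq> \<zero>" using assms one_not_zero by auto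
  have "y = y \<otimes> (x \<otimes> inv x)" using inv_props(2)[OF assms(1) nz] assms by simp
  also have "\<dots> = inv x" using inv_props(1)[OF assms(1) nz] assms by (simp del: Units_r_inv add: m_assoc[symmetric])
  finally show ?thesis by simp
qed

text \<open>A subring that contains the inverses, taken in the big ring, of its nonzero elements: in this form
  intersections, unions of chains and centralizers are seen to be division subrings.\<close>

lemma division_subring_iff:
  "division_subring S R \<longleftrightarrow> S \<subseteq> carrier R \<and> \<one> \<in> S \<and>
     (\<forall>a\<in>S. \<forall>b\<in>S. a \<oplus> b \<in> S \<and> a \<otimes> b \<in> S) \<and> (\<forall>a\<in>S. \<ominus> a \<in> S) \<and>
     (\<forall>a\<in>S. a \<noteq> \<zero> \<longrightarrow> inv a \<in> S)"
proof
  assume div: "division_subring S R"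
  then interpret S: skewfield "R\<lparr>carrier := S\<rparr>"
    by (simp add: division_subring_def)
  have sub: "subring S R" using div by (simp add: division_subring_def)
  have "inv a \<in> S" if "a \<in> S" "a \<noteq> \<zero>" for a
  proof -
    have "a \<in> Units (R\<lparr>carrier := S\<rparr>)" using S.skewfield_Units that by simp
    then obtain b where b: "b \<in> S" "b \<otimes> a = \<one>" by (auto simp: Units_def)
    have "inv a = b"
      using b that subringE(1)[OF sub] by (intro inv_unique_left) auto
    thus ?thesis using b by simp
  qed
  thus "S \<subseteq> carrier R \<and> \<one> \<in> S \<and>
     (\<forall>a\<in>S. \<forall>b\<in>S. a \<oplus> b \<in> S \<and> a \<otimes> b \<in> S) \<and> (\<forall>a\<in>S. \<ominus> a \<in> S) \<and>
     (\<forall>a\<in>S. a \<noteq> \<zero> \<longrightarrow> inv a \<in> S)"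
    using subringE[OF sub] by auto
next
  assume S: "S \<subseteq> carrier R \<and> \<one> \<in> S \<and>
     (\<forall>a\<in>S. \<forall>b\<in>S. a \<oplus> b \<in> S \<and> a \<otimes> b \<in> S) \<and> (\<forall>a\<in>S. \<ominus> a \<in> S) \<and>
     (\<forall>a\<in>S. a \<noteq> \<zero> \<longrightarrow> inv a \<in> S)"
  have sub: "subring S R" using S by (intro subringI) auto
  interpret S: ring "R\<lparr>carrier := S\<rparr>" using subring_is_ring[OF sub] .
  have "Units (R\<lparr>carrier := S\<rparr>) = S - {\<zero>}"
  proof
    show "Units (R\<lparr>carrier := S\<rparr>) \<subseteq> S - {\<zero>}"
      using S one_not_zero by (auto simp: Units_def subset_iff)
    show "S - {\<zero>} \<subseteq> Units (R\<lparr>carrier := S\<rparr>)"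
    proof
      fix a assume "a \<in> S - {\<zero>}"
      moreover from this have "inv a \<in> S" "a \<otimes> inv a = \<one>" "inv a \<otimes> a = \<one>"
        using S inv_props by auto
      ultimately show "a \<in> Units (R\<lparr>carrier := S\<rparr>)" by (auto simp: Units_def)
    qed
  qed
  hence "skewfield (R\<lparr>carrier := S\<rparr>)"
    using one_not_zero by unfold_locales auto
  thus "division_subring S R" using sub by (simp add: division_subring_def)
qed

lemma division_subringE:
  assumes "division_subring S R"
  shows "S \<subseteq> carrier R" "\<one> \<in> S" "\<And>a b. a \<in> S \<Longrightarrow> b \<in> S \<Longrightarrow> a \<oplus> b \<in> S"
    "\<And>a b. a \<in> S \<Longrightarrow> b \<in> S \<Longrightarrow> a \<otimes> b \<in> S" "\<And>a. a \<in> S \<Longrightarrow> \<ominus> a \<in> S"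
    "\<And>a. a \<in> S \<Longrightarrow> a \<noteq> \<zero> \<Longrightarrow> inv a \<in> S"
    "\<And>a b. a \<in> S \<Longrightarrow> b \<in> S \<Longrightarrow> a \<ominus> b \<in> S" "subring S R" "skewfield (R\<lparr>carrier := S\<rparr>)"
proof -
  note iff = assms[unfolded division_subring_iff]
  show "subring S R" "skewfield (R\<lparr>carrier := S\<rparr>)"
    using assms by (auto simp: division_subring_def)
  show "S \<subseteq> carrier R" "\<one> \<in> S" using iff by simp_all
  show "a \<oplus> b \<in> S" "a \<otimes> b \<in> S" "a \<ominus> b \<in> S" if "a \<in> S" "b \<in> S" for a b
    using iff that by (simp_all add: minus_eq)
  show "\<ominus> a \<in> S" "a \<noteq> \<zero> \<Longrightarrow> inv a \<in> S" if "a \<in> S" for a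
    using iff that by simp_all
qed

lemma division_subring_Inter:
  assumes "\<And>S. S \<in> SS \<Longrightarrow> division_subring S R" "SS \<noteq> {}"
  shows "division_subring (\<Inter>SS) R"
proof -
  note E = division_subringE[OF assms(1)]
  have "\<Inter>SS \<subseteq> carrier R" using E(1) assms(2) by (meson Inf_less_eq)
  moreover have "\<one> \<in> \<Inter>SS" by (simp add: E(2))
  moreover have "a \<oplus> b \<in> \<Inter>SS" "a \<otimes> b \<in> \<Inter>SS" if "a \<in> \<Inter>SS" "b \<in> \<Inter>SS" for a b
    using that by (simp_all add: E(3,4))
  moreover have "\<ominus> a \<in> \<Inter>SS" if "a \<in> \<Inter>SS" for a
    using that by (simp add: E(5))
  moreover have "inv a \<in> \<Inter>SS" if "a \<in> \<Inter>SS" "a \<noteq> \<zero>" for a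
    using that by (simp add: E(6))
  ultimately show ?thesis unfolding division_subring_iff by simp
qed

lemma division_subring_Int:
  assumes "division_subring S R" "division_subring T R"
  shows "division_subring (S \<inter> T) R"
proof -
  have "division_subring (\<Inter>{S, T}) R"
    by (rule division_subring_Inter) (use assms in blast)+
  thus ?thesis by simp
qed

lemma division_subring_carrier: "division_subring (carrier R) R"
  unfolding division_subring_iff by (simp add: inv_props(1))

lemma division_subring_generated:
  assumes "A \<subseteq> carrier R"
  shows "division_subring (generated_division_subring R A) R"
  unfolding generated_division_subring_def hull_def
proof (rule division_subring_Inter)
  show "{t. division_subring t R \<and> A \<subseteq> t} \<noteq> {}"
    using assms division_subring_carrier by blast
qed simp

lemma division_subring_chain:
  fixes S :: "nat \<Rightarrow> 'a set"
  assumes "\<And>n. division_subring (S n) R" "mono S"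
  shows "division_subring (\<Union>n. S n) R"
proof -
  have up: "\<exists>n. x \<in> S n \<and> y \<in> S n" if "x \<in> S m" "y \<in> S n" for x y m n
    using that monoD[OF assms(2), of m "max m n"] monoD[OF assms(2), of n "max m n"] by auto
  show ?thesis unfolding division_subring_iff
  proof (intro conjI ballI impI)
    fix a b assume "a \<in> (\<Union>n. S n)" "b \<in> (\<Union>n. S n)"
    then obtain n where n: "a \<in> S n" "b \<in> S n" using up by (elim UN_E) metis
    show "a \<oplus> b \<in> (\<Union>n. S n)" "a \<otimes> b \<in> (\<Union>n. S n)"
      using division_subringE(3,4)[OF assms(1) n] by blast+
  next
    fix a assume "a \<in> (\<Union>n. S n)"
    then obtain n where n: "a \<in> S n" by blast
    show "\<ominus> a \<in> (\<Union>n. S n)"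
      using division_subringE(5)[OF assms(1) n] by (rule UN_I[OF UNIV_I])
    show "inv a \<in> (\<Union>n. S n)" if "a \<noteq> \<zero>"
      using division_subringE(6)[OF assms(1) n that] by (rule UN_I[OF UNIV_I])
  next
    show "(\<Union>n. S n) \<subseteq> carrier R" by (rule UN_least) (rule division_subringE(1)[OF assms(1)])
    show "\<one> \<in> (\<Union>n. S n)" by (rule UN_I[OF UNIV_I]) (rule division_subringE(2)[OF assms(1)])
  qed
qed

end

definition centralizer :: "('a, 'm) ring_scheme \<Rightarrow> 'a set \<Rightarrow> 'a set" where
  "centralizer R A = {z \<in> carrier R. \<forall>a \<in> A. z \<otimes>\<^bsub>R\<^esub> a = a \<otimes>\<^bsub>R\<^esub> z}"

lemma center_commutes:
  assumes "z \<in> center R" "x \<in> carrier R"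
  shows "z \<otimes>\<^bsub>R\<^esub> x = x \<otimes>\<^bsub>R\<^esub> z"
  using assms unfolding center_def by blast

lemma center_eq_centralizer: "center R = centralizer R (carrier R)"
  by (simp add: center_def centralizer_def)

context skewfield
begin

lemma commute_inv:
  assumes "z \<in> carrier R" "a \<in> carrier R" "a \<noteq> \<zero>" "z \<otimes> a = a \<otimes> z"
  shows "z \<otimes> inv a = inv a \<otimes> z"
proof -
  note i = inv_props[OF assms(2,3)]
  have "z \<otimes> inv a = (inv a \<otimes> a) \<otimes> (z \<otimes> inv a)"
    using assms(1) i by simp
  also have "\<dots> = inv a \<otimes> (a \<otimes> z) \<otimes> inv a"
    using assms(1,2) i(1) by (simp add: m_assoc)
  also have "\<dots> = inv a \<otimes> (z \<otimes> a) \<otimes> inv a" using assms(4) by simp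
  also have "\<dots> = inv a \<otimes> z \<otimes> (a \<otimes> inv a)"
    using assms(1,2) i(1) by (simp add: m_assoc)
  also have "\<dots> = inv a \<otimes> z" using assms(1) i by simp
  finally show ?thesis .
qed

lemma division_subring_centralizer:
  assumes "A \<subseteq> carrier R"
  shows "division_subring (centralizer R A) R"
proof -
  let ?C = "centralizer R A"
  have A: "a \<in> carrier R" if "a \<in> A" for a using assms that by blast
  have C: "x \<in> carrier R" "\<And>a. a \<in> A \<Longrightarrow> x \<otimes> a = a \<otimes> x" if "x \<in> ?C" for x
    using that unfolding centralizer_def by blast+
  have CI: "x \<in> ?C" if "x \<in> carrier R" "\<And>a. a \<in> A \<Longrightarrow> x \<otimes> a = a \<otimes> x" for x
    using that unfolding centralizer_def by blast
  have "x \<otimes> y \<in> ?C" if x: "x \<in> ?C" and y: "y \<in> ?C" for x y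
  proof (rule CI)
    fix a assume a: "a \<in> A"
    show "x \<otimes> y \<otimes> a = a \<otimes> (x \<otimes> y)"
      using C[OF x] C[OF y] A[OF a] a by (metis m_assoc)
  qed (use C(1) x y in simp)
  moreover have "x \<oplus> y \<in> ?C" if x: "x \<in> ?C" and y: "y \<in> ?C" for x y
    by (rule CI) (simp_all add: C(1)[OF x] C(1)[OF y] A l_distr r_distr C(2)[OF x] C(2)[OF y])
  moreover have "\<ominus> x \<in> ?C" if x: "x \<in> ?C" for x
    by (rule CI) (simp_all add: C(1)[OF x] A l_minus r_minus C(2)[OF x])
  moreover have "inv x \<in> ?C" if x: "x \<in> ?C" "x \<noteq> \<zero>" for x
  proof (rule CI)
    fix a assume a: "a \<in> A"
    show "inv x \<otimes> a = a \<otimes> inv x"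
      using commute_inv[OF A[OF a] C(1)[OF x(1)] x(2)] C(2)[OF x(1) a] by metis
  qed (rule inv_props(1)[OF C(1)[OF x(1)] x(2)])
  moreover have "\<one> \<in> ?C" by (rule CI) (simp_all add: A)
  moreover have "?C \<subseteq> carrier R" using C(1) by blast
  ultimately show ?thesis unfolding division_subring_iff by simp
qed

lemma division_subring_center: "division_subring (center R) R"
  unfolding center_eq_centralizer by (rule division_subring_centralizer) simp

text \<open>Makes the linear algebra and the polynomials over subfields applicable inside a noncommutative
  division ring.\<close>

lemma commutative_division_subring_subfield:
  assumes "division_subring S R" "\<And>a b. a \<in> S \<Longrightarrow> b \<in> S \<Longrightarrow> a \<otimes> b = b \<otimes> a"
  shows "subfield S R"
proof -
  note E = division_subringE[OF assms(1)]
  have "subcring S R" using E(8) assms(2) by (simp add: subcring_def subcring_axioms_def)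
  moreover have "subdomain_axioms S R"
    unfolding subdomain_axioms_def using one_not_zero domain_property E(1) by blast
  ultimately have "subdomain S R" by (simp add: subdomain_def)
  thus ?thesis
    by (rule subfield.intro) (use skewfield.skewfield_Units[OF E(9)] in \<open>simp add: subfield_axioms_def\<close>)
qed

lemma center_subfield: "subfield (center R) R"
proof (rule commutative_division_subring_subfield[OF division_subring_center])
  fix a b assume "a \<in> center R" "b \<in> center R"
  thus "a \<otimes> b = b \<otimes> a"
    using center_commutes[of a R b] division_subringE(1)[OF division_subring_center] by blast
qed

end

section \<open>Splitting by a quaternion pair\<close>

lemma in_centralizer:
  "z \<in> centralizer R A \<longleftrightarrow> z \<in> carrier R \<and> (\<forall>a\<in>A. z \<otimes>\<^bsub>R\<^esub> a = a \<otimes>\<^bsub>R\<^esub> z)"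
  by (simp add: centralizer_def)

context skewfield
begin

lemma anticommute_inv:
  assumes "z \<in> carrier R" "a \<in> carrier R" "a \<noteq> \<zero>" "z \<otimes> a = \<ominus> (a \<otimes> z)"
  shows "z \<otimes> inv a = \<ominus> (inv a \<otimes> z)"
proof -
  note i = inv_props[OF assms(2,3)]
  have "\<ominus> (inv a \<otimes> z) = \<ominus> (inv a \<otimes> (z \<otimes> a) \<otimes> inv a)"
    using assms(1,2) i by (simp add: m_assoc)
  also have "\<dots> = (inv a \<otimes> a) \<otimes> z \<otimes> inv a"
    unfolding assms(4) using assms(1,2) i(1) by (simp add: m_assoc l_minus r_minus)
  also have "\<dots> = z \<otimes> inv a" using assms(1) i by simp
  finally show ?thesis by simp
qed

lemma anticommuting_product_commutes:
  assumes "x \<in> carrier R" "y \<in> carrier R" "z \<in> carrier R"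
    "x \<otimes> z = \<ominus> (z \<otimes> x)" "y \<otimes> z = \<ominus> (z \<otimes> y)"
  shows "x \<otimes> y \<otimes> z = z \<otimes> (x \<otimes> y)"
proof -
  have "x \<otimes> y \<otimes> z = x \<otimes> (y \<otimes> z)" using assms(1-3) by (simp add: m_assoc)
  also have "\<dots> = \<ominus> (x \<otimes> z \<otimes> y)"
    unfolding assms(5) using assms(1-3) by (simp add: m_assoc r_minus)
  also have "\<dots> = z \<otimes> (x \<otimes> y)"
    unfolding assms(4) using assms(1-3) by (simp add: m_assoc l_minus)
  finally show ?thesis .
qed

text \<open>Conjugation by \<open>t\<close> maps the centralizer of \<open>s\<close> to the centralizer of \<open>t s t\<^sup>-\<^sup>1 = - s\<close>, which is the
  same set.\<close>

lemma conjugate_commutes: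
  assumes "w \<in> carrier R" "s \<in> carrier R" "t \<in> carrier R" "t \<noteq> \<zero>"
    "s \<otimes> t = \<ominus> (t \<otimes> s)" "w \<otimes> s = s \<otimes> w"
  shows "t \<otimes> w \<otimes> inv t \<otimes> s = s \<otimes> (t \<otimes> w \<otimes> inv t)"
proof -
  note i = inv_props[OF assms(3,4)]
  have it: "inv t \<otimes> s = \<ominus> (s \<otimes> inv t)"
    using anticommute_inv[OF assms(2,3,4,5)] assms(2) i(1) by simp
  have "t \<otimes> w \<otimes> inv t \<otimes> s = t \<otimes> w \<otimes> (inv t \<otimes> s)"
    using assms(1-3) i(1) by (simp add: m_assoc)
  also have "\<dots> = \<ominus> (t \<otimes> (w \<otimes> s) \<otimes> inv t)"
    unfolding it using assms(1-3) i(1) by (simp add: m_assoc r_minus)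
  also have "\<dots> = (\<ominus> (t \<otimes> s)) \<otimes> w \<otimes> inv t"
    unfolding assms(6) using assms(1-3) i(1) by (simp add: m_assoc l_minus)
  also have "\<dots> = s \<otimes> (t \<otimes> w \<otimes> inv t)"
    unfolding assms(5)[symmetric] using assms(1-3) i(1) by (simp add: m_assoc)
  finally show ?thesis .
qed

text \<open>Since \<open>s\<^sup>2\<close> commutes with \<open>y\<close>, conjugation by \<open>s\<close> acts as an involution on \<open>y\<close>;
  the two parts are half the sum and half the difference of \<open>y\<close> and its conjugate.\<close>

lemma split_by_conjugation:
  assumes C: "division_subring C R" and s: "s \<in> carrier R" "s \<noteq> \<zero>"
    and y: "y \<in> C" "s \<otimes> y \<otimes> inv s \<in> C"
    and ss: "s \<otimes> s \<otimes> y = y \<otimes> (s \<otimes> s)" and two: "\<one> \<oplus> \<one> \<noteq> \<zero>"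
  obtains u v where "u \<in> C" "v \<in> C" "y = u \<oplus> v" "u \<otimes> s = s \<otimes> u" "v \<otimes> s = \<ominus> (s \<otimes> v)"
proof -
  note E = division_subringE[OF C] and i = inv_props[OF s]
  define h where "h = inv (\<one> \<oplus> \<one>)"
  have hC: "h \<in> C" unfolding h_def using E two by simp
  hence h: "h \<in> carrier R" using E(1) by blast
  have h2: "h \<otimes> (\<one> \<oplus> \<one>) = \<one>" unfolding h_def using inv_props two by simp
  have hs: "s \<otimes> h = h \<otimes> s"
    unfolding h_def by (rule commute_inv) (use s two in \<open>simp_all add: l_distr r_distr\<close>)
  define z where "z = s \<otimes> y \<otimes> inv s"
  have yc: "y \<in> carrier R" and zc: "z \<in> carrier R" and zC: "z \<in> C"
    using y E(1) unfolding z_def by blast+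
  have zs: "z \<otimes> s = s \<otimes> y" unfolding z_def using yc s i by (simp add: m_assoc)
  have "s \<otimes> z = (s \<otimes> s \<otimes> y) \<otimes> inv s" unfolding z_def using yc s i(1) by (simp add: m_assoc)
  also have "\<dots> = y \<otimes> s" unfolding ss using yc s i by (simp add: m_assoc)
  finally have sz: "s \<otimes> z = y \<otimes> s" .
  have sh: "s \<otimes> (h \<otimes> w) = h \<otimes> (s \<otimes> w)" if "w \<in> carrier R" for w
    using that hs s h by (simp add: m_assoc[symmetric])
  show thesis
  proof
    show "h \<otimes> (y \<oplus> z) \<in> C" "h \<otimes> (y \<ominus> z) \<in> C" using E hC y zC by simp_all
    have "h \<otimes> (y \<oplus> z) \<oplus> h \<otimes> (y \<ominus> z) = h \<otimes> (y \<oplus> y \<oplus> (z \<ominus> z))"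
      using h yc zc by (simp add: r_distr[symmetric] minus_eq a_ac del: r_neg)
    also have "\<dots> = h \<otimes> (\<one> \<oplus> \<one>) \<otimes> y"
      using h yc zc by (simp add: m_assoc l_distr r_distr minus_eq r_minus r_neg)
    finally show "y = h \<otimes> (y \<oplus> z) \<oplus> h \<otimes> (y \<ominus> z)" using h2 yc by simp
    show "h \<otimes> (y \<oplus> z) \<otimes> s = s \<otimes> (h \<otimes> (y \<oplus> z))"
      using h yc zc s by (simp add: sh m_assoc l_distr r_distr zs sz a_ac)
    show "h \<otimes> (y \<ominus> z) \<otimes> s = \<ominus> (s \<otimes> (h \<otimes> (y \<ominus> z)))"
      using h yc zc s
      by (simp add: sh m_assoc l_distr r_distr zs sz a_ac minus_eq l_minus r_minus minus_add)
  qed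
qed

text \<open>Split by conjugation with \<open>s\<close>, then each part by conjugation with \<open>t\<close>. An element that
  anticommutes with \<open>s\<close> is turned into one that commutes with \<open>s\<close> by the factor \<open>t\<^sup>-\<^sup>1\<close>, and
  symmetrically, so all four coefficients end up in the centralizer of both.\<close>

lemma quaternion_decomposition:
  assumes C: "division_subring C R" and s: "s \<in> C" "s \<noteq> \<zero>" and t: "t \<in> C" "t \<noteq> \<zero>"
    and st: "s \<otimes> t = \<ominus> (t \<otimes> s)" and sq: "s \<otimes> s \<in> center R" "t \<otimes> t \<in> center R"
    and two: "\<one> \<oplus> \<one> \<noteq> \<zero>" and y: "y \<in> C"
  obtains a b c d where "{a, b, c, d} \<subseteq> C \<inter> centralizer R {s, t}"
    "y = (a \<oplus> c \<otimes> s) \<oplus> (b \<oplus> d \<otimes> s) \<otimes> t"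
proof -
  note E = division_subringE[OF C]
  have car: "x \<in> carrier R" if "x \<in> C" for x using that E(1) by blast
  note inv_s = inv_props[OF car[OF s(1)] s(2)] and inv_t = inv_props[OF car[OF t(1)] t(2)]
  have isC: "inv s \<in> C" and itC: "inv t \<in> C" using E s t by simp_all
  have ts: "t \<otimes> s = \<ominus> (s \<otimes> t)" using st car s t by simp
  have inv_t_s: "inv t \<otimes> s = \<ominus> (s \<otimes> inv t)"
    using anticommute_inv[OF car[OF s(1)] car[OF t(1)] t(2) st] car s inv_t(1) by simp
  have inv_s_t: "inv s \<otimes> t = \<ominus> (t \<otimes> inv s)"
    using anticommute_inv[OF car[OF t(1)] car[OF s(1)] s(2) ts] car t inv_s(1) by simp
  let ?C' = "C \<inter> centralizer R {s}"
  have C': "division_subring ?C' R"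
    by (intro division_subring_Int C division_subring_centralizer) (simp add: car s)
  have split: "\<exists>p q. {p, q} \<subseteq> C \<inter> centralizer R {s, t} \<and> w = p \<oplus> q \<otimes> s" if w: "w \<in> ?C'" for w
  proof -
    have wC: "w \<in> C" "w \<otimes> s = s \<otimes> w" using w by (auto simp: in_centralizer)
    have "t \<otimes> w \<otimes> inv t \<in> ?C'"
      using conjugate_commutes[OF car[OF wC(1)] car[OF s(1)] car[OF t(1)] t(2) st wC(2)] E wC t itC car
      by (simp add: in_centralizer)
    then obtain p q where pq: "p \<in> ?C'" "q \<in> ?C'" "w = p \<oplus> q" "p \<otimes> t = t \<otimes> p" "q \<otimes> t = \<ominus> (t \<otimes> q)"
      using split_by_conjugation[OF C' car[OF t(1)] t(2) w _ center_commutes[OF sq(2) car[OF wC(1)]] two]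
      by metis
    have qs: "q \<in> C" "s \<otimes> q = q \<otimes> s" using pq(2) by (simp_all add: in_centralizer)
    have "q \<otimes> inv s \<otimes> t = t \<otimes> (q \<otimes> inv s)"
      by (rule anticommuting_product_commutes) (use car qs inv_s t pq inv_s_t in auto)
    moreover have "q \<otimes> inv s \<otimes> s = s \<otimes> (q \<otimes> inv s)"
    proof -
      have "s \<otimes> (q \<otimes> inv s) = (s \<otimes> q) \<otimes> inv s"
        using car qs(1) inv_s(1) s by (simp add: m_assoc)
      also have "\<dots> = q" unfolding qs(2) using car qs(1) inv_s s by (simp add: m_assoc)
      finally show ?thesis using car qs(1) inv_s s by (simp add: m_assoc)
    qed
    ultimately have "q \<otimes> inv s \<in> C \<inter> centralizer R {s, t}"
      using E isC qs(1) car by (simp add: in_centralizer)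
    moreover have "p \<in> C \<inter> centralizer R {s, t}" using pq by (simp add: in_centralizer)
    moreover have "w = p \<oplus> (q \<otimes> inv s) \<otimes> s"
      using car qs(1) inv_s s pq by (simp add: m_assoc)
    ultimately show ?thesis by blast
  qed
  have "s \<otimes> y \<otimes> inv s \<in> C" using E y s isC by simp
  then obtain u v where uv: "u \<in> C" "v \<in> C" "y = u \<oplus> v" "u \<otimes> s = s \<otimes> u" "v \<otimes> s = \<ominus> (s \<otimes> v)"
    using split_by_conjugation[OF C car[OF s(1)] s(2) y _ center_commutes[OF sq(1) car[OF y]] two]
    by metis
  have "v \<otimes> inv t \<otimes> s = s \<otimes> (v \<otimes> inv t)"
    by (rule anticommuting_product_commutes) (use car uv inv_t s inv_t_s in auto)
  hence "v \<otimes> inv t \<in> ?C'" using E itC uv car by (simp add: in_centralizer)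
  then obtain b d where bd: "{b, d} \<subseteq> C \<inter> centralizer R {s, t}" "v \<otimes> inv t = b \<oplus> d \<otimes> s"
    using split by metis
  have "u \<in> ?C'" using uv car by (simp add: in_centralizer)
  then obtain a c where ac: "{a, c} \<subseteq> C \<inter> centralizer R {s, t}" "u = a \<oplus> c \<otimes> s"
    using split by metis
  have "y = u \<oplus> (v \<otimes> inv t) \<otimes> t" using uv inv_t car t by (simp add: m_assoc)
  thus thesis using that[of a b c d] bd ac by simp
qed

end

section \<open>Central finiteness\<close>

context skewfield
begin

lemma Span_append:
  assumes "set Us \<subseteq> carrier R" "set Vs \<subseteq> carrier R" "K \<subseteq> carrier R"
    "u \<in> Span K Us" "v \<in> Span K Vs"
  shows "u \<oplus> v \<in> Span K (Us @ Vs)"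
  using assms(1,4)
proof (induction Us arbitrary: u)
  case Nil
  thus ?case using Span_in_carrier[OF assms(3,2)] assms(5) by auto
next
  case (Cons a Us)
  then obtain k w where k: "k \<in> K" "w \<in> Span K Us" "u = k \<otimes> a \<oplus> w"
    by (auto simp: line_extension_mem_iff)
  have "k \<in> carrier R" "a \<in> carrier R" "w \<in> carrier R" "v \<in> carrier R"
    using k Cons.prems subsetD[OF Span_in_carrier[OF assms(3)]] assms by auto
  hence "u \<oplus> v = k \<otimes> a \<oplus> (w \<oplus> v)" unfolding k(3) by (simp add: a_assoc)
  moreover have "w \<oplus> v \<in> Span K (Us @ Vs)" using Cons k by simp
  ultimately show ?case using k(1) by (auto simp: line_extension_mem_iff)
qed

lemma Span_r_mult:
  assumes "set Us \<subseteq> carrier R" "K \<subseteq> carrier R" "u \<in> Span K Us" "m \<in> carrier R"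
  shows "u \<otimes> m \<in> Span K (map (\<lambda>b. b \<otimes> m) Us)"
  using assms(1,3)
proof (induction Us arbitrary: u)
  case Nil
  thus ?case using assms(4) by simp
next
  case (Cons a Us)
  then obtain k w where k: "k \<in> K" "w \<in> Span K Us" "u = k \<otimes> a \<oplus> w"
    by (auto simp: line_extension_mem_iff)
  have "k \<in> carrier R" "a \<in> carrier R" "w \<in> carrier R"
    using k Cons.prems subsetD[OF Span_in_carrier[OF assms(2), of Us]] assms by auto
  hence "u \<otimes> m = k \<otimes> (a \<otimes> m) \<oplus> w \<otimes> m"
    unfolding k(3) using assms(4) by (simp add: l_distr m_assoc)
  moreover have "w \<otimes> m \<in> Span K (map (\<lambda>b. b \<otimes> m) Us)" using Cons k by simp
  ultimately show ?case using k(1) by (auto simp: line_extension_mem_iff)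
qed

text \<open>Let \<open>C\<^sub>k\<close> be the centralizer of the first \<open>k\<close> pairs. The quaternion decomposition expresses \<open>C\<^sub>k\<close>
  by four copies of \<open>C\<^sub>k\<^sub>+\<^sub>1\<close>, so descending from \<open>k = n\<close> to \<open>C\<^sub>0\<close>, the whole ring, carries two properties along: commuting
  with the elements of \<open>C\<^sub>n\<close>, which makes these central, and being contained in the span of finitely many
  elements over the center.\<close>

lemma centrally_finite_of_quaternion_generators:
  fixes s t :: "nat \<Rightarrow> 'a"
  assumes s: "\<And>i. i < n \<Longrightarrow> s i \<in> carrier R" "\<And>i. i < n \<Longrightarrow> s i \<noteq> \<zero>"
    and t: "\<And>i. i < n \<Longrightarrow> t i \<in> carrier R" "\<And>i. i < n \<Longrightarrow> t i \<noteq> \<zero>"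
    and ss: "\<And>i j. i < n \<Longrightarrow> j < n \<Longrightarrow> s i \<otimes> s j = s j \<otimes> s i"
    and tt: "\<And>i j. i < n \<Longrightarrow> j < n \<Longrightarrow> t i \<otimes> t j = t j \<otimes> t i"
    and st: "\<And>i j. i < n \<Longrightarrow> j < n \<Longrightarrow> i \<noteq> j \<Longrightarrow> s i \<otimes> t j = t j \<otimes> s i"
    and anti: "\<And>i. i < n \<Longrightarrow> s i \<otimes> t i \<oplus> t i \<otimes> s i = \<zero>"
    and sq: "\<And>i. i < n \<Longrightarrow> s i \<otimes> s i \<in> center R" "\<And>i. i < n \<Longrightarrow> t i \<otimes> t i \<in> center R"
    and two: "\<one> \<oplus> \<one> \<noteq> \<zero>"
    and comm: "\<And>c d. c \<in> centralizer R (s ` {..<n} \<union> t ` {..<n}) \<Longrightarrow>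
       d \<in> centralizer R (s ` {..<n} \<union> t ` {..<n}) \<Longrightarrow> c \<otimes> d = d \<otimes> c"
  shows "centrally_finite R"
proof -
  define C where "C k = centralizer R (s ` {..<k} \<union> t ` {..<k})" for k
  have C_div: "division_subring (C k) R" if "k \<le> n" for k
    unfolding C_def by (rule division_subring_centralizer) (use that s t in auto)
  have C_Suc: "C k \<inter> centralizer R {s k, t k} = C (Suc k)" for k
    unfolding C_def by (auto simp: in_centralizer less_Suc_eq)
  have decomp: "\<exists>a b c d. {a, b, c, d} \<subseteq> C (Suc k) \<and> y = (a \<oplus> c \<otimes> s k) \<oplus> (b \<oplus> d \<otimes> s k) \<otimes> t k"
    if k: "k < n" and y: "y \<in> C k" for k y
  proof -
    have "s k \<in> C k" "t k \<in> C k" unfolding C_def in_centralizer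
      using s t k ss[of k] tt[of k] st[of k] st[of _ k] by auto
    moreover have "s k \<otimes> t k = \<ominus> (t k \<otimes> s k)"
      using minus_equality[OF anti[OF k]] s t k by simp
    ultimately obtain a b c d where "{a, b, c, d} \<subseteq> C k \<inter> centralizer R {s k, t k}"
      "y = (a \<oplus> c \<otimes> s k) \<oplus> (b \<oplus> d \<otimes> s k) \<otimes> t k"
      using quaternion_decomposition[OF C_div _ s(2) _ t(2) _ sq two y] k by (metis less_imp_le)
    thus ?thesis unfolding C_Suc by blast
  qed
  have CK: "C 0 = carrier R" unfolding C_def by (auto simp: in_centralizer)
  have commute: "\<forall>y\<in>C k. z \<otimes> y = y \<otimes> z" if "k \<le> n" and z: "z \<in> C n" for k z
    using that(1)
  proof (induction k rule: inc_induct)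
    case base
    show ?case using comm z unfolding C_def by blast
  next
    case (step k)
    have zc: "z \<in> carrier R" using z unfolding C_def in_centralizer by blast
    note E = division_subringE[OF division_subring_centralizer[of "{z}"]]
    have gen: "s k \<in> centralizer R {z}" "t k \<in> centralizer R {z}"
      using z s t step(2) unfolding C_def in_centralizer by auto
    have "C (Suc k) \<subseteq> centralizer R {z}"
    proof
      fix y assume "y \<in> C (Suc k)"
      moreover from this have "y \<in> carrier R"
        using division_subringE(1)[OF C_div[of "Suc k"]] step(2) by auto
      ultimately show "y \<in> centralizer R {z}"
        using step.IH unfolding in_centralizer by simp
    qed
    hence sub: "y \<in> centralizer R {z}" if "y \<in> C (Suc k)" for y using that by blast
    have "y \<in> centralizer R {z}" if y: "y \<in> C k" for y
    proof -
      obtain a b c d where "{a, b, c, d} \<subseteq> C (Suc k)"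
        "y = (a \<oplus> c \<otimes> s k) \<oplus> (b \<oplus> d \<otimes> s k) \<otimes> t k" using decomp[OF step(2) y] by metis
      thus ?thesis using sub gen zc by (simp add: E(3,4))
    qed
    thus ?case unfolding in_centralizer by auto
  qed
  have ZC: "C n \<subseteq> center R"
  proof
    fix z assume z: "z \<in> C n"
    hence "z \<in> carrier R" unfolding C_def in_centralizer by blast
    thus "z \<in> center R" using commute[OF le0 z] unfolding CK center_def by blast
  qed
  have Zc: "center R \<subseteq> carrier R" by (auto simp: center_def)
  have span: "\<exists>Bs. set Bs \<subseteq> carrier R \<and> C k \<subseteq> Span (center R) Bs" if "k \<le> n" for k
    using that
  proof (induction k rule: inc_induct)
    case base
    have "z \<in> Span (center R) [\<one>]" if "z \<in> C n" for z
      using that ZC Zc by (auto simp: line_extension_mem_iff intro!: bexI[of _ z])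
    thus ?case by (intro exI[of _ "[\<one>]"]) auto
  next
    case (step k)
    then obtain Bs where Bs: "set Bs \<subseteq> carrier R" "C (Suc k) \<subseteq> Span (center R) Bs" by blast
    define Cs where "Cs = Bs @ map (\<lambda>b. b \<otimes> s k) Bs"
    define Ds where "Ds = Cs @ map (\<lambda>b. b \<otimes> t k) Cs"
    have sc: "s k \<in> carrier R" and tc: "t k \<in> carrier R" using s t step(2) by auto
    have Cs: "set Cs \<subseteq> carrier R" unfolding Cs_def using Bs(1) sc by auto
    have Ds: "set Ds \<subseteq> carrier R" unfolding Ds_def using Cs tc by auto
    have inCs: "a \<oplus> c \<otimes> s k \<in> Span (center R) Cs" if "a \<in> C (Suc k)" "c \<in> C (Suc k)" for a c
      unfolding Cs_def using that Bs sc Zc by (intro Span_append Span_r_mult) auto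
    have inDs: "x \<oplus> w \<otimes> t k \<in> Span (center R) Ds"
      if "x \<in> Span (center R) Cs" "w \<in> Span (center R) Cs" for x w
      unfolding Ds_def using that Cs tc Zc by (intro Span_append Span_r_mult) auto
    have "C k \<subseteq> Span (center R) Ds"
    proof
      fix y assume "y \<in> C k"
      then obtain a b c d where "{a, b, c, d} \<subseteq> C (Suc k)"
        "y = (a \<oplus> c \<otimes> s k) \<oplus> (b \<oplus> d \<otimes> s k) \<otimes> t k" using decomp[OF step(2)] by metis
      thus "y \<in> Span (center R) Ds" using inDs inCs by simp
    qed
    thus ?case using Ds by blast
  qed
  obtain Bs where Bs: "set Bs \<subseteq> carrier R" "carrier R \<subseteq> Span (center R) Bs"
    using span[OF le0] CK by auto
  hence "Span (center R) Bs = carrier R" using Span_in_carrier[OF Zc Bs(1)] by blast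
  hence "finite_dimension (center R) (carrier R)"
    using Span_finite_dimension[OF center_subfield Bs(1)] by simp
  thus ?thesis unfolding centrally_finite_def using skewfield_axioms by simp
qed

end

section \<open>Division rings generated by a tower of quaternion pairs\<close>

text \<open>Central coefficients pass through \<open>s\<close>, so a conjugate of a root is a root.\<close>

lemma (in skewfield) eval_conjugate:
  assumes "set f \<subseteq> center R" "x \<in> carrier R" "s \<in> carrier R" "x \<otimes> s = s \<otimes> y" "y \<in> carrier R"
  shows "eval f x \<otimes> s = s \<otimes> eval f y"
proof -
  have pow: "x [^] n \<otimes> s = s \<otimes> y [^] n" for n :: nat
  proof (induction n)
    case (Suc n)
    have "x [^] Suc n \<otimes> s = x [^] n \<otimes> (x \<otimes> s)"
      using assms by (simp add: m_assoc)
    also have "\<dots> = (x [^] n \<otimes> s) \<otimes> y" unfolding assms(4) using assms by (simp add: m_assoc)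
    also have "\<dots> = s \<otimes> y [^] Suc n" unfolding Suc using assms by (simp add: m_assoc)
    finally show ?case .
  qed (use assms in simp)
  have Zc: "center R \<subseteq> carrier R" by (auto simp: center_def)
  show ?thesis using assms(1)
  proof (induction f)
    case (Cons a f)
    have a: "a \<in> center R" "a \<in> carrier R" "set f \<subseteq> carrier R" using Cons.prems Zc by auto
    have ev: "eval f x \<in> carrier R" "eval f y \<in> carrier R"
      using a assms(2,5) by (simp_all add: eval_in_carrier)
    have "eval (a # f) x \<otimes> s = a \<otimes> (x [^] length f \<otimes> s) \<oplus> eval f x \<otimes> s"
      using a ev assms by (simp add: l_distr m_assoc)
    also have "\<dots> = (a \<otimes> s) \<otimes> y [^] length f \<oplus> s \<otimes> eval f y"
      unfolding pow using a assms Cons by (simp add: m_assoc)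
    also have "\<dots> = s \<otimes> eval (a # f) y"
      unfolding center_commutes[OF a(1) assms(3)] using a ev assms by (simp add: r_distr m_assoc)
    finally show ?case .
  qed (use assms in simp)
qed

text \<open>The relation \<open>alpha_s\<close> says that conjugation by \<open>s i\<close> changes the sign of the single summand \<open>t i\<close>
  of \<open>\<alpha>\<close>. The two centralizer conditions replace all knowledge of the coefficients of a series.\<close>

locale quaternion_tower = skewfield R for R (structure) +
  fixes s t :: "nat \<Rightarrow> 'a" and \<alpha> :: 'a
  assumes s_carrier: "s i \<in> carrier R" and t_carrier: "t i \<in> carrier R"
    and s_nonzero: "s i \<noteq> \<zero>" and t_nonzero: "t i \<noteq> \<zero>"
    and ss: "s i \<otimes> s j = s j \<otimes> s i" and tt: "t i \<otimes> t j = t j \<otimes> t i"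
    and st: "i \<noteq> j \<Longrightarrow> s i \<otimes> t j = t j \<otimes> s i"
    and anti: "s i \<otimes> t i \<oplus> t i \<otimes> s i = \<zero>"
    and two: "\<one> \<oplus> \<one> \<noteq> \<zero>"
    and t_centralizer_commutative:
      "c \<in> centralizer R (range t) \<Longrightarrow> d \<in> centralizer R (range t) \<Longrightarrow> c \<otimes> d = d \<otimes> c"
    and center_by_generators: "centralizer R (range s \<union> range t) \<subseteq> center R"
    and alpha_carrier: "\<alpha> \<in> carrier R" and alpha_t: "\<alpha> \<otimes> t i = t i \<otimes> \<alpha>"
    and alpha_s: "\<alpha> \<otimes> s i = s i \<otimes> (\<alpha> \<ominus> (t i \<oplus> t i))"
    and inj_t: "inj t"
begin

definition \<Delta> :: "'a set" where
  "\<Delta> = generated_division_subring R (center R \<union> {\<alpha>} \<union> range s)"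

lemma generators_in_\<Delta>: "center R \<union> {\<alpha>} \<union> range s \<subseteq> \<Delta>"
  unfolding \<Delta>_def generated_division_subring_def by (rule hull_subset)

lemma \<Delta>_minimal: "division_subring S R \<Longrightarrow> center R \<union> {\<alpha>} \<union> range s \<subseteq> S \<Longrightarrow> \<Delta> \<subseteq> S"
  unfolding \<Delta>_def generated_division_subring_def by (rule hull_minimal)

lemma division_subring_\<Delta>: "division_subring \<Delta> R"
  unfolding \<Delta>_def using s_carrier alpha_carrier
  by (intro division_subring_generated) (auto simp: center_def)

text \<open>Half of \<open>\<alpha> - s\<^sub>i\<^sup>-\<^sup>1 \<alpha> s\<^sub>i\<close>.\<close>

lemma t_in_\<Delta>: "t i \<in> \<Delta>"
proof -
  note E = division_subringE[OF division_subring_\<Delta>]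
  note c = s_carrier[of i] t_carrier[of i] alpha_carrier
  note inv_s = inv_props[OF s_carrier s_nonzero, of i] and inv_2 = inv_props[OF _ two]
  have "\<alpha> \<ominus> (inv (s i) \<otimes> s i) \<otimes> (\<alpha> \<ominus> (t i \<oplus> t i)) = t i \<oplus> t i"
    unfolding inv_s(3) using c by algebra
  hence "t i \<oplus> t i = \<alpha> \<ominus> inv (s i) \<otimes> (\<alpha> \<otimes> s i)"
    unfolding alpha_s using c inv_s(1) by (simp add: m_assoc)
  also have "\<dots> \<in> \<Delta>"
  proof -
    have "s i \<in> \<Delta>" "\<alpha> \<in> \<Delta>" using generators_in_\<Delta> by auto
    thus ?thesis using s_nonzero by (simp add: E)
  qed
  finally have "inv (\<one> \<oplus> \<one>) \<otimes> (t i \<oplus> t i) \<in> \<Delta>"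
    using E two by simp
  also have "t i \<oplus> t i = (\<one> \<oplus> \<one>) \<otimes> t i" using c by (simp add: l_distr)
  also have "inv (\<one> \<oplus> \<one>) \<otimes> ((\<one> \<oplus> \<one>) \<otimes> t i) = t i"
    using c inv_2 by (simp add: m_assoc[symmetric])
  finally show ?thesis .
qed

text \<open>The division ring \<open>E\<^sub>n\<close> that witnesses the Kurosh property: only the first \<open>n\<close> quaternion pairs are
  visible in it, but it contains \<open>\<alpha>\<close> for every \<open>n\<close>.\<close>

definition layer :: "nat \<Rightarrow> 'a set" where
  "layer n = \<Delta> \<inter> centralizer R (t ` {n..})"

lemma division_subring_layer: "division_subring (layer n) R"
  unfolding layer_def using t_carrier
  by (intro division_subring_Int division_subring_\<Delta> division_subring_centralizer) auto

lemma layer_mono: "m \<le> n \<Longrightarrow> layer m \<subseteq> layer n"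
  by (auto simp: layer_def in_centralizer)

lemma s_in_layer: "i < n \<Longrightarrow> s i \<in> layer n"
  using generators_in_\<Delta> s_carrier st[of i] by (auto simp: layer_def in_centralizer)

lemma t_in_layer: "t i \<in> layer n"
  using t_in_\<Delta> t_carrier tt by (auto simp: layer_def in_centralizer)

text \<open>The union of the layers is a division subring because they form a chain, and every generator
  lies in some layer: \<open>s i\<close> commutes with all \<open>t j\<close> except \<open>t i\<close>.\<close>

lemma \<Delta>_eq_Union_layer: "\<Delta> = (\<Union>n. layer n)"
proof
  show "(\<Union>n. layer n) \<subseteq> \<Delta>" by (auto simp: layer_def)
  have center: "z \<in> layer 0" if "z \<in> center R" for z
    using that generators_in_\<Delta> center_commutes[OF that t_carrier]
    by (auto simp: layer_def in_centralizer center_def)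
  have alpha: "\<alpha> \<in> layer 0"
    using generators_in_\<Delta> alpha_carrier alpha_t by (auto simp: layer_def in_centralizer)
  have s: "s i \<in> layer (Suc i)" for i by (rule s_in_layer) simp
  show "\<Delta> \<subseteq> (\<Union>n. layer n)"
  proof (rule \<Delta>_minimal)
    show "division_subring (\<Union>n. layer n) R"
      by (rule division_subring_chain[OF division_subring_layer monoI[OF layer_mono]])
    show "center R \<union> {\<alpha>} \<union> range s \<subseteq> (\<Union>n. layer n)"
      using center alpha s by blast
  qed
qed

text \<open>The square of a generator commutes with the one generator that anticommutes with it, since two
  signs cancel.\<close>

lemma squares_central: "s i \<otimes> s i \<in> center R" "t i \<otimes> t i \<in> center R"
proof -
  have anti': "s j \<otimes> t j = \<ominus> (t j \<otimes> s j)" for j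
    using minus_equality[OF anti[of j]] s_carrier t_carrier by simp
  hence anti'': "t j \<otimes> s j = \<ominus> (s j \<otimes> t j)" for j
    using s_carrier t_carrier by simp
  have comm: "x \<otimes> x \<otimes> y = y \<otimes> (x \<otimes> x)"
    if "x \<in> carrier R" "y \<in> carrier R" "x \<otimes> y = y \<otimes> x" for x y
    using that by (metis m_assoc)
  have "s i \<otimes> s i \<otimes> t j = t j \<otimes> (s i \<otimes> s i)" "t i \<otimes> t i \<otimes> s j = s j \<otimes> (t i \<otimes> t i)" for j
    using comm[OF s_carrier t_carrier st] comm[OF t_carrier s_carrier st[symmetric]]
      anticommuting_product_commutes[OF s_carrier s_carrier t_carrier anti' anti']
      anticommuting_product_commutes[OF t_carrier t_carrier s_carrier anti'' anti'']
    by (cases "i = j"; metis)+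
  thus "s i \<otimes> s i \<in> center R" "t i \<otimes> t i \<in> center R"
    using comm[OF s_carrier s_carrier ss] comm[OF t_carrier t_carrier tt] s_carrier t_carrier
    by (intro subsetD[OF center_by_generators]; auto simp: in_centralizer)+
qed

lemma centralizer_sub: "S \<subseteq> carrier R \<Longrightarrow> centralizer (R\<lparr>carrier := S\<rparr>) A = S \<inter> centralizer R A"
  by (auto simp: centralizer_def)

lemma center_sub: "S \<subseteq> carrier R \<Longrightarrow> z \<in> center R \<Longrightarrow> z \<in> S \<Longrightarrow> z \<in> center (R\<lparr>carrier := S\<rparr>)"
  by (auto simp: center_def)

text \<open>An element of the layer commutes with \<open>t i\<close> for \<open>i \<ge> n\<close>; if it also commutes with the first \<open>n\<close>
  pairs, it centralizes all \<open>t i\<close>, and such elements commute with each other.\<close>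

lemma centrally_finite_layer: "centrally_finite (R\<lparr>carrier := layer n\<rparr>)"
proof -
  note E = division_subringE[OF division_subring_layer[of n]]
  interpret L: skewfield "R\<lparr>carrier := layer n\<rparr>" by (rule E(9))
  show ?thesis
  proof (rule L.centrally_finite_of_quaternion_generators[of n s t])
    fix i assume i: "i < n"
    show "s i \<otimes>\<^bsub>R\<lparr>carrier := layer n\<rparr>\<^esub> s i \<in> center (R\<lparr>carrier := layer n\<rparr>)"
      "t i \<otimes>\<^bsub>R\<lparr>carrier := layer n\<rparr>\<^esub> t i \<in> center (R\<lparr>carrier := layer n\<rparr>)"
      using s_in_layer[OF i] t_in_layer[of i n] E(4)
      by (auto intro!: center_sub[OF E(1)] squares_central)
  next
    fix c d
    assume "c \<in> centralizer (R\<lparr>carrier := layer n\<rparr>) (s ` {..<n} \<union> t ` {..<n})"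
      "d \<in> centralizer (R\<lparr>carrier := layer n\<rparr>) (s ` {..<n} \<union> t ` {..<n})"
    moreover have "z \<in> centralizer R (range t)"
      if "z \<in> layer n \<inter> centralizer R (s ` {..<n} \<union> t ` {..<n})" for z
    proof -
      have "z \<otimes> t i = t i \<otimes> z" for i
        using that by (cases "i < n") (auto simp: layer_def in_centralizer)
      thus ?thesis using that by (auto simp: in_centralizer)
    qed
    ultimately show "c \<otimes>\<^bsub>R\<lparr>carrier := layer n\<rparr>\<^esub> d = d \<otimes>\<^bsub>R\<lparr>carrier := layer n\<rparr>\<^esub> c"
      using t_centralizer_commutative by (simp add: centralizer_sub[OF E(1)])
  qed (use s_in_layer t_in_layer s_nonzero t_nonzero ss tt st anti two in auto)
qed

lemma center_\<Delta>: "center (R\<lparr>carrier := \<Delta>\<rparr>) = center R"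
proof
  note E = division_subringE[OF division_subring_\<Delta>]
  show "center R \<subseteq> center (R\<lparr>carrier := \<Delta>\<rparr>)"
    using center_sub[OF E(1)] generators_in_\<Delta> by blast
  show "center (R\<lparr>carrier := \<Delta>\<rparr>) \<subseteq> center R"
  proof
    fix z assume z: "z \<in> center (R\<lparr>carrier := \<Delta>\<rparr>)"
    hence zc: "z \<in> carrier R" using E(1) by (auto simp: center_def)
    have "z \<otimes> a = a \<otimes> z" if "a \<in> range s \<union> range t" for a
      using center_commutes[OF z, of a] that generators_in_\<Delta> t_in_\<Delta> by auto
    with zc show "z \<in> center R"
      by (intro subsetD[OF center_by_generators]) (simp add: in_centralizer)
  qed
qed

lemma kurosh_\<Delta>:
  assumes "x \<in> \<Delta>" "x \<notin> center R"
  shows "kurosh (R\<lparr>carrier := \<Delta>\<rparr>) x"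
proof -
  have xc: "x \<in> carrier R" using assms division_subringE(1)[OF division_subring_\<Delta>] by blast
  obtain m where m: "x \<in> layer m" using assms(1) \<Delta>_eq_Union_layer by blast
  obtain i where i: "x \<otimes> s i \<noteq> s i \<otimes> x \<or> x \<otimes> t i \<noteq> t i \<otimes> x"
    using assms(2) center_by_generators xc unfolding in_centralizer subset_iff by blast
  define n where "n = max m (Suc i)"
  have x: "x \<in> layer n" using m layer_mono[of m n] by (auto simp: n_def)
  note E = division_subringE[OF division_subring_layer[of n]]
  have "x \<notin> center (R\<lparr>carrier := layer n\<rparr>)"
    using i s_in_layer[of i n] t_in_layer[of i n]
      center_commutes[of x "R\<lparr>carrier := layer n\<rparr>" "s i"]
      center_commutes[of x "R\<lparr>carrier := layer n\<rparr>" "t i"] by (auto simp: n_def)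
  moreover have "layer n \<subseteq> \<Delta>" by (auto simp: layer_def)
  moreover have "subring (layer n) (R\<lparr>carrier := \<Delta>\<rparr>)"
    using ring.subring_iff[OF subring_is_ring[OF division_subringE(8)[OF division_subring_\<Delta>]]]
      subring_is_ring[OF E(8)] \<open>layer n \<subseteq> \<Delta>\<close> by simp
  ultimately show ?thesis
    unfolding kurosh_def division_subring_def using assms x centrally_finite_layer[of n] E(9)
    by (auto simp: center_\<Delta> intro!: exI[of _ "layer n"])
qed

text \<open>The roots \<open>\<alpha> - 2 t\<^sub>i\<close>, conjugate to \<open>\<alpha>\<close>, all lie in the field of elements that commute with every
  \<open>t\<^sub>i\<close>, where a nonzero polynomial has only finitely many roots.\<close>

lemma alpha_transcendental:
  assumes f: "f \<in> carrier (univ_poly R (center R))" "eval f \<alpha> = \<zero>"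
  shows "f = []"
proof (rule ccontr)
  assume nonempty: "f \<noteq> []"
  define C where "C = centralizer R (range t)"
  have C: "division_subring C R"
    unfolding C_def by (rule division_subring_centralizer) (use t_carrier in auto)
  note E = division_subringE[OF C]
  have sub: "subfield C R"
    by (rule commutative_division_subring_subfield[OF C]) (simp add: C_def t_centralizer_commutative)
  interpret L: domain "R\<lparr>carrier := C\<rparr>"
    by (rule subdomain_is_domain[OF subfield.axioms(1)[OF sub]])
  have center_C: "center R \<subseteq> C"
    using t_carrier by (auto simp: C_def in_centralizer center_def)
  have coeffs: "set f \<subseteq> center R" "hd f \<noteq> \<zero>"
    using f(1) nonempty by (auto simp: sym[OF univ_poly_carrier] polynomial_def)
  have fC: "f \<in> carrier (poly_ring (R\<lparr>carrier := C\<rparr>))"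
    using coeffs center_C by (auto simp: sym[OF univ_poly_carrier] polynomial_def)
  define r where "r i = \<alpha> \<ominus> (t i \<oplus> t i)" for i
  have aC: "\<alpha> \<in> C" "t i \<in> C" for i
    unfolding C_def in_centralizer using alpha_carrier t_carrier alpha_t tt by auto
  have rC: "r i \<in> C" for i unfolding r_def using E aC by simp
  hence rc: "r i \<in> carrier R" for i using E(1) by blast
  have "eval f (r i) = \<zero>" for i
  proof (rule domain_property[OF s_carrier _ _ s_nonzero])
    show "eval f (r i) \<in> carrier R"
      by (rule eval_in_carrier) (use coeffs rc in \<open>auto simp: center_def\<close>)
    show "s i \<otimes> eval f (r i) = \<zero>"
      using eval_conjugate[OF coeffs(1) alpha_carrier s_carrier alpha_s[folded r_def] rc] f(2) s_carrier by simp
  qed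
  hence "range r \<subseteq> {x. L.is_root f x}"
    using rC nonempty E(8) by (auto simp: L.is_root_def)
  hence "finite (range r)" using L.finite_number_of_roots[OF fC] finite_subset by blast
  moreover have "inj r"
  proof (rule injI)
    fix i j assume "r i = r j"
    hence "\<alpha> \<ominus> r i = \<alpha> \<ominus> r j" by simp
    hence "t i \<oplus> t i = t j \<oplus> t j"
      unfolding r_def using alpha_carrier t_carrier[of i] t_carrier[of j] by algebra
    hence "(\<one> \<oplus> \<one>) \<otimes> (t i \<ominus> t j) = \<zero>"
      using t_carrier[of i] t_carrier[of j] by algebra
    hence "t i \<ominus> t j = \<zero>" using domain_property[of "\<one> \<oplus> \<one>"] two t_carrier by simp
    hence "t i = t j" using t_carrier by simp
    thus "i = j" using inj_t by (simp add: inj_eq)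
  qed
  ultimately show False using finite_imageD infinite_UNIV_nat by blast
qed

theorem generated_tower:
  "skewfield (R\<lparr>carrier := \<Delta>\<rparr>) \<and> \<not> algebraic_skewfield (R\<lparr>carrier := \<Delta>\<rparr>) \<and>
   (\<forall>x \<in> \<Delta> - center (R\<lparr>carrier := \<Delta>\<rparr>). kurosh (R\<lparr>carrier := \<Delta>\<rparr>) x)"
proof -
  note E = division_subringE[OF division_subring_\<Delta>]
  have "\<not> algebraic_skewfield (R\<lparr>carrier := \<Delta>\<rparr>)"
  proof
    assume "algebraic_skewfield (R\<lparr>carrier := \<Delta>\<rparr>)"
    then obtain f where "f \<in> carrier (univ_poly (R\<lparr>carrier := \<Delta>\<rparr>) (center R))" "f \<noteq> []"
      "ring.eval (R\<lparr>carrier := \<Delta>\<rparr>) f \<alpha> = \<zero>"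
      using generators_in_\<Delta> by (auto simp: algebraic_skewfield_def center_\<Delta>)
    thus False using alpha_transcendental univ_poly_consistent[OF E(8)] eval_consistent[OF E(8)] by simp
  qed
  thus ?thesis using E(9) kurosh_\<Delta> by (simp add: center_\<Delta>)
qed

end

section \<open>The multiquadratic field\<close>

lemma ring_of_type_algebra_simps [simp]:
  "carrier ring_of_type_algebra = UNIV"
  "\<one>\<^bsub>ring_of_type_algebra\<^esub> = 1" "\<zero>\<^bsub>ring_of_type_algebra\<^esub> = 0"
  "x \<oplus>\<^bsub>ring_of_type_algebra\<^esub> y = x + y" "x \<otimes>\<^bsub>ring_of_type_algebra\<^esub> y = x * y"
  by (simp_all add: ring_of_type_algebra_def)

lemma ring_of_type_algebra_inverses:
  fixes x :: "'a :: field"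
  shows "\<ominus>\<^bsub>ring_of_type_algebra\<^esub> x = - x"
    and "x \<noteq> 0 \<Longrightarrow> inv\<^bsub>ring_of_type_algebra\<^esub> x = inverse x"
proof -
  interpret F: field "ring_of_type_algebra :: 'a ring" by (rule field_from_type_algebra)
  show "\<ominus>\<^bsub>ring_of_type_algebra\<^esub> x = - x"
    by (rule F.minus_equality) simp_all
  show "inv\<^bsub>ring_of_type_algebra\<^esub> x = inverse x" if "x \<noteq> 0"
    by (rule F.inv_unique'[symmetric]) (use that in simp_all)
qed

locale sqrt_tower =
  fixes p :: "nat \<Rightarrow> nat"
  assumes prime: "\<And>i. Factorial_Ring.prime (p i)" and strict_mono: "strict_mono p"
begin

abbreviation rt :: "nat \<Rightarrow> real" where "rt i \<equiv> sqrt (real (p i))"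

lemma rt_square: "rt i * rt i = real (p i)"
  by simp

lemma rt_pos: "rt i > 0"
  using prime[of i] prime_gt_0_nat by simp

text \<open>The field \<open>\<rat>(\<surd>p\<^sub>0, \<dots>, \<surd>p\<^sub>n\<^sub>-\<^sub>1)\<close>; the square root with index \<open>n\<close> is adjoined at step
  \<open>n + 1\<close>.\<close>

fun L :: "nat \<Rightarrow> real set" where
  "L 0 = \<rat>"
| "L (Suc n) = {a + b * rt n | a b. a \<in> L n \<and> b \<in> L n}"

lemma L_Suc_iff: "x \<in> L (Suc n) \<longleftrightarrow> (\<exists>a\<in>L n. \<exists>b\<in>L n. x = a + b * rt n)"
  by auto

lemma rat_in_L: "q \<in> \<rat> \<Longrightarrow> q \<in> L n"
proof (induction n)
  case (Suc n)
  have "0 \<in> L n" by (induction n) (auto intro!: exI[of _ 0])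
  moreover have "q = q + 0 * rt n" by simp
  ultimately show ?case using Suc unfolding L_Suc_iff by blast
qed simp

lemma zero_in_L: "0 \<in> L n" and one_in_L: "1 \<in> L n"
  by (auto intro: rat_in_L)

lemma L_Suc: "x \<in> L n \<Longrightarrow> x \<in> L (Suc n)"
  using zero_in_L[of n] unfolding L_Suc_iff by force

lemma L_mono: "m \<le> n \<Longrightarrow> L m \<subseteq> L n"
  by (rule lift_Suc_mono_le) (use L_Suc in blast)+

lemma rt_in_L: "i < n \<Longrightarrow> rt i \<in> L n"
proof -
  assume "i < n"
  have "rt i \<in> L (Suc i)" unfolding L_Suc_iff using zero_in_L one_in_L by force
  thus ?thesis using L_mono[of "Suc i" n] \<open>i < n\<close> by (auto simp del: L.simps)
qed

lemma L_add: "x \<in> L n \<Longrightarrow> y \<in> L n \<Longrightarrow> x + y \<in> L n"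
proof (induction n arbitrary: x y)
  case (Suc n)
  then obtain a b c d where "{a, b, c, d} \<subseteq> L n" "x = a + b * rt n" "y = c + d * rt n"
    unfolding L_Suc_iff by auto
  moreover from this have "x + y = (a + c) + (b + d) * rt n" by (simp add: algebra_simps)
  ultimately show ?case unfolding L_Suc_iff using Suc.IH by blast
qed simp

lemma L_mult: "x \<in> L n \<Longrightarrow> y \<in> L n \<Longrightarrow> x * y \<in> L n"
proof (induction n arbitrary: x y)
  case (Suc n)
  then obtain a b c d where "{a, b, c, d} \<subseteq> L n" "x = a + b * rt n" "y = c + d * rt n"
    unfolding L_Suc_iff by auto
  moreover from this have "x * y = (a * c + b * d * real (p n)) + (a * d + b * c) * rt n"
  proof -
    have "(a + b * r) * (c + d * r) = (a * c + b * d * (r * r)) + (a * d + b * c) * r" for r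
      by (simp add: algebra_simps)
    thus ?thesis using calculation by simp
  qed
  moreover have "real (p n) \<in> L n" by (rule rat_in_L) simp
  ultimately show ?case unfolding L_Suc_iff using Suc.IH L_add by (metis insert_subset)
qed simp

lemma L_uminus: "x \<in> L n \<Longrightarrow> - x \<in> L n"
  using L_mult[of "-1" n x] rat_in_L[of "-1" n] by simp

lemma L_diff: "x \<in> L n \<Longrightarrow> y \<in> L n \<Longrightarrow> x - y \<in> L n"
  using L_add[of x n "-y"] L_uminus by simp

text \<open>The usual rationalization, by the conjugate \<open>a - b\<surd>p\<^sub>n\<close>. If that conjugate vanishes, \<open>x\<close> equals
  \<open>2 a\<close> and lies in the smaller field already. This case has to be treated because the proof that
  the extension is proper uses inverses.\<close>

lemma L_inverse: "x \<in> L n \<Longrightarrow> inverse x \<in> L n"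
proof (induction n arbitrary: x)
  case (Suc n)
  then obtain a b where ab: "a \<in> L n" "b \<in> L n" "x = a + b * rt n"
    unfolding L_Suc_iff by auto
  define c where "c = inverse (a * a - b * b * real (p n))"
  have pn: "real (p n) \<in> L n" by (rule rat_in_L) simp
  have c: "c \<in> L n" unfolding c_def by (intro Suc.IH L_diff L_mult ab pn)
  show ?case
  proof (cases "a - b * rt n = 0")
    case True
    hence "x = 2 * a" using ab by simp
    moreover have "2 * a \<in> L n" using L_add[OF ab(1) ab(1)] by simp
    ultimately have "inverse x \<in> L n" using Suc.IH by metis
    thus ?thesis by (rule L_Suc)
  next
    case False
    have "(a - b * r) * (a + b * r) = a * a - b * b * (r * r)" for r
      by (simp add: algebra_simps)
    hence "a * a - b * b * real (p n) = (a - b * rt n) * x" unfolding ab by simp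
    hence "inverse x = c * (a - b * rt n)" unfolding c_def using False by simp
    hence "inverse x = c * a + (- (c * b)) * rt n" by (simp add: algebra_simps)
    moreover have "c * a \<in> L n" "- (c * b) \<in> L n" using c ab L_mult L_uminus by blast+
    ultimately show ?thesis unfolding L_Suc_iff by blast
  qed
qed simp

text \<open>If \<open>\<surd>p\<^sub>n\<close> were rational times the square root of a product of other primes \<open>p\<^sub>i\<close>, squaring would
  give an equation in which the multiplicity of \<open>p\<^sub>n\<close> is odd on one side and even on the other.\<close>

lemma sqrt_prime_not_in_L_step:
  assumes "\<And>r. 0 \<le> r \<Longrightarrow> r \<in> \<rat> \<Longrightarrow> sqrt r \<in> L n \<Longrightarrow> \<exists>S\<subseteq>{..<n}. \<exists>q\<in>\<rat>. sqrt r = q * sqrt (real (\<Prod>i\<in>S. p i))"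
  shows "rt n \<notin> L n"
proof
  assume "rt n \<in> L n"
  then obtain S q where S: "S \<subseteq> {..<n}" "q \<in> \<rat>" "rt n = q * sqrt (real (\<Prod>i\<in>S. p i))"
    using assms[of "real (p n)"] by auto
  let ?m = "\<Prod>i\<in>S. p i"
  obtain a b where ab: "b \<noteq> 0" "\<bar>q\<bar> = real a / real b" "coprime a b" by (rule Rats_abs_nat_div_natE[OF S(2)])
  have "real (p n) = q\<^sup>2 * real ?m"
    using arg_cong[OF S(3), of "\<lambda>x. x\<^sup>2"] by (simp add: power_mult_distrib prod_nonneg)
  also have "q\<^sup>2 = (real a / real b)\<^sup>2" unfolding ab(2)[symmetric] by simp
  finally have "real (p n * b\<^sup>2) = real (a\<^sup>2 * ?m)" using ab(1) by (simp add: field_simps)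
  hence eq: "p n * b\<^sup>2 = a\<^sup>2 * ?m" by (simp only: of_nat_eq_iff)
  have fin: "finite S" using S(1) finite_subset by blast
  have m0: "?m \<noteq> 0" using prime fin by (simp add: prime_gt_0_nat)
  have "\<not> p n dvd ?m"
  proof
    assume "p n dvd ?m"
    then obtain i where "i \<in> S" "p n dvd p i" using prime_dvd_prod_iff[OF fin prime] by blast
    hence "p n = p i" using prime primes_dvd_imp_eq by blast
    thus False using strict_mono_eq[OF strict_mono] \<open>i \<in> S\<close> S(1) by auto
  qed
  hence mm: "multiplicity (p n) ?m = 0" by (rule not_dvd_imp_multiplicity_0)
  have pe: "prime_elem (p n)" using prime by auto
  have a0: "a \<noteq> 0" using eq ab(1) prime[of n] by (metis mult_eq_0_iff not_prime_0 power_eq_0_iff zero_power2)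
  have "multiplicity (p n) (p n * b\<^sup>2) = 1 + 2 * multiplicity (p n) b"
    using pe ab(1) prime_elem_multiplicity_mult_distrib[OF pe, of "p n" "b\<^sup>2"]
      prime_elem_multiplicity_power_distrib[OF pe, of b 2] prime[of n]
    by (auto simp: multiplicity_same_power prime_gt_0_nat)
  moreover have "multiplicity (p n) (a\<^sup>2 * ?m) = 2 * multiplicity (p n) a"
    using pe a0 m0 mm prime_elem_multiplicity_mult_distrib[OF pe, of "a\<^sup>2" ?m]
      prime_elem_multiplicity_power_distrib[OF pe, of a 2] by auto
  ultimately have "1 + 2 * multiplicity (p n) b = 2 * multiplicity (p n) a" unfolding eq by simp
  thus False by presburger
qed

text \<open>Square \<open>\<surd>r = a + b \<surd>p\<^sub>n\<close>. If \<open>a b \<noteq> 0\<close>, then \<open>\<surd>p\<^sub>n\<close> would lie in the smaller field. If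
  \<open>b = 0\<close>, the induction hypothesis applies to \<open>r\<close>, and if \<open>a = 0\<close>, to \<open>r p\<^sub>n\<close>. The statement is
  about all rational \<open>r\<close> at once for the sake of this last case.\<close>

lemma sqrt_in_L:
  assumes "0 \<le> r" "r \<in> \<rat>" "sqrt r \<in> L n"
  shows "\<exists>S\<subseteq>{..<n}. \<exists>q\<in>\<rat>. sqrt r = q * sqrt (real (\<Prod>i\<in>S. p i))"
  using assms
proof (induction n arbitrary: r)
  case 0
  thus ?case by auto
next
  case (Suc n)
  obtain a b where ab: "a \<in> L n" "b \<in> L n" "sqrt r = a + b * rt n"
    using Suc.prems(3) unfolding L_Suc_iff by auto
  have notin: "rt n \<notin> L n" using Suc.IH by (intro sqrt_prime_not_in_L_step)
  consider "b = 0" | "a = 0" | "a \<noteq> 0" "b \<noteq> 0" by blast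
  thus ?case
  proof cases
    case 1
    hence "sqrt r \<in> L n" using ab by simp
    then obtain S q where "S \<subseteq> {..<n}" "q \<in> \<rat>" "sqrt r = q * sqrt (real (\<Prod>i\<in>S. p i))"
      using Suc by blast
    thus ?thesis by (intro exI[of _ S]) (auto simp: less_Suc_eq)
  next
    case 2
    have "sqrt (r * real (p n)) = b * real (p n)"
      using ab 2 rt_square[of n] by (simp add: real_sqrt_mult)
    hence "sqrt (r * real (p n)) \<in> L n" using L_mult[OF ab(2) rat_in_L[of "real (p n)"]] by simp
    then obtain S q where S: "S \<subseteq> {..<n}" "q \<in> \<rat>" "sqrt (r * real (p n)) = q * sqrt (real (\<Prod>i\<in>S. p i))"
      using Suc.IH[of "r * real (p n)"] Suc.prems by auto
    have "n \<notin> S" "finite S" using S(1) finite_subset by blast+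
    hence "sqrt (real (\<Prod>i\<in>insert n S. p i)) = rt n * sqrt (real (\<Prod>i\<in>S. p i))"
      by (simp add: real_sqrt_mult)
    moreover have "sqrt r = sqrt (r * real (p n)) * rt n / real (p n)"
      using rt_square[of n] rt_pos[of n] by (simp only: real_sqrt_mult) (simp add: field_simps)
    ultimately have "sqrt r = q / real (p n) * sqrt (real (\<Prod>i\<in>insert n S. p i))"
      using S(3) by simp
    moreover have "q / real (p n) \<in> \<rat>" using S(2) by simp
    moreover have "insert n S \<subseteq> {..<Suc n}" using S(1) by auto
    ultimately show ?thesis by blast
  next
    case 3
    have "r = (sqrt r)\<^sup>2" using Suc.prems by simp
    also have "\<dots> = a * a + b * b * (rt n * rt n) + 2 * a * b * rt n"
      unfolding ab(3) by (simp only: power2_eq_square algebra_simps)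
    also have "rt n * rt n = real (p n)" by (rule rt_square)
    finally have "rt n = (r - a * a - b * b * real (p n)) * inverse (2 * a * b)"
      using 3 by (simp add: field_simps)
    also have "\<dots> \<in> L n"
      by (intro L_mult L_diff L_inverse ab rat_in_L) (use Suc.prems in auto)
    finally show ?thesis using notin by blast
  qed
qed

lemma rt_notin_L: "rt n \<notin> L n"
  by (rule sqrt_prime_not_in_L_step) (rule sqrt_in_L)

lemma L_Suc_unique:
  assumes "a \<in> L n" "b \<in> L n" "c \<in> L n" "d \<in> L n" "a + b * rt n = c + d * rt n"
  shows "a = c \<and> b = d"
proof -
  have "b = d"
  proof (rule ccontr)
    assume "b \<noteq> d"
    hence "rt n = (a - c) * inverse (d - b)" using assms(5) by (simp add: field_simps)
    also have "\<dots> \<in> L n" using assms by (intro L_mult L_diff L_inverse)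
    finally show False using rt_notin_L by blast
  qed
  thus ?thesis using assms(5) by simp
qed

lemma K_set_eq: "K_set p = (\<Union>n. L n)"
proof
  let ?U = "\<Union>n. L n"
  have up: "\<exists>n. x \<in> L n \<and> y \<in> L n" if "x \<in> ?U" "y \<in> ?U" for x y
  proof -
    from that obtain m n where "x \<in> L m" "y \<in> L n" by (elim UN_E)
    thus ?thesis using L_mono[of m "max m n"] L_mono[of n "max m n"] by auto
  qed
  show "K_set p \<subseteq> ?U"
  proof
    fix x assume "x \<in> K_set p"
    thus "x \<in> ?U" unfolding K_set_def
    proof (induction rule: generate_field.induct)
      case one
      thus ?case using one_in_L by auto
    next
      case (incl h)
      thus ?case using rat_in_L[of h 0] rt_in_L by blast
    next
      case (a_inv h)
      thus ?case using L_uminus by (auto simp: ring_of_type_algebra_inverses)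
    next
      case (m_inv h)
      thus ?case using L_inverse by (auto simp: ring_of_type_algebra_inverses)
    next
      case (eng_add x y)
      thus ?case using up[of x y] L_add by auto
    next
      case (eng_mult x y)
      thus ?case using up[of x y] L_mult by auto
    qed
  qed
  have "x \<in> L n \<Longrightarrow> x \<in> K_set p" for n x
  proof (induction n arbitrary: x)
    case 0
    thus ?case unfolding K_set_def by (auto intro: generate_field.incl)
  next
    case (Suc n)
    then obtain a b where ab: "a \<in> L n" "b \<in> L n" "x = a + b * rt n" unfolding L_Suc_iff by auto
    have r: "rt n \<in> K_set p" unfolding K_set_def by (auto intro: generate_field.incl)
    have "b * rt n \<in> K_set p"
      using generate_field.eng_mult[OF Suc.IH[OF ab(2), unfolded K_set_def] r[unfolded K_set_def]]
      by (simp add: K_set_def)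
    from generate_field.eng_add[OF Suc.IH[OF ab(1), unfolded K_set_def] this[unfolded K_set_def]]
    show ?case by (simp add: K_set_def ab)
  qed
  thus "?U \<subseteq> K_set p" by blast
qed

end

section \<open>The action by sign changes\<close>

context sqrt_tower
begin

text \<open>The coordinates with respect to the basis \<open>1, \<surd>p\<^sub>n\<close> of \<open>L (n + 1)\<close> over \<open>L n\<close>.\<close>

definition coord :: "nat \<Rightarrow> real \<Rightarrow> real \<times> real" where
  "coord n x = (SOME (a, b). a \<in> L n \<and> b \<in> L n \<and> x = a + b * rt n)"

lemma coord_eq:
  assumes "a \<in> L n" "b \<in> L n"
  shows "coord n (a + b * rt n) = (a, b)"
  unfolding coord_def
proof (rule some_equality)
  fix y :: "real \<times> real"
  assume "case y of (c, d) \<Rightarrow> c \<in> L n \<and> d \<in> L n \<and> a + b * rt n = c + d * rt n"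
  thus "y = (a, b)" using L_Suc_unique[OF assms] by (cases y) auto
qed (use assms in simp)

text \<open>The automorphism of \<open>L n\<close> that multiplies \<open>\<surd>p\<^sub>i\<close> by \<open>e i\<close>. Independence of the square roots enters
  through the uniqueness of coordinates.\<close>

fun level_aut :: "(nat \<Rightarrow> real) \<Rightarrow> nat \<Rightarrow> real \<Rightarrow> real" where
  "level_aut e 0 x = x"
| "level_aut e (Suc n) x = level_aut e n (fst (coord n x)) + e n * level_aut e n (snd (coord n x)) * rt n"

lemma level_aut_Suc [simp]:
  "a \<in> L n \<Longrightarrow> b \<in> L n \<Longrightarrow> level_aut e (Suc n) (a + b * rt n) = level_aut e n a + e n * level_aut e n b * rt n"
  by (simp add: coord_eq)

declare level_aut.simps(2) [simp del] L.simps(2) [simp del]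

lemma L_SucE:
  assumes "x \<in> L (Suc n)"
  obtains a b where "a \<in> L n" "b \<in> L n" "x = a + b * rt n"
  using assms unfolding L_Suc_iff by blast

lemma level_aut_zero: "level_aut e n 0 = 0"
proof (induction n)
  case (Suc n)
  thus ?case using level_aut_Suc[OF zero_in_L zero_in_L, of e n] by simp
qed simp

lemma level_aut_Suc_L: "x \<in> L n \<Longrightarrow> level_aut e (Suc n) x = level_aut e n x"
  using level_aut_Suc[OF _ zero_in_L, of x n e] by (simp add: level_aut_zero)

lemma level_aut_mono: "m \<le> n \<Longrightarrow> x \<in> L m \<Longrightarrow> level_aut e n x = level_aut e m x"
proof (induction n rule: dec_induct)
  case (step n)
  thus ?case using level_aut_Suc_L[of x n] L_mono[of m n] by auto
qed simp

lemma level_aut_rat: "q \<in> \<rat> \<Longrightarrow> level_aut e n q = q"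
  using level_aut_mono[of 0 n q e] by simp

lemma level_aut_add: "x \<in> L n \<Longrightarrow> y \<in> L n \<Longrightarrow> level_aut e n (x + y) = level_aut e n x + level_aut e n y"
proof (induction n arbitrary: x y)
  case (Suc n)
  obtain a b where x: "a \<in> L n" "b \<in> L n" "x = a + b * rt n" using Suc.prems(1) by (rule L_SucE)
  obtain c d where y: "c \<in> L n" "d \<in> L n" "y = c + d * rt n" using Suc.prems(2) by (rule L_SucE)
  have xy: "x + y = (a + c) + (b + d) * rt n" unfolding x y by (simp add: distrib_right)
  have "level_aut e (Suc n) (x + y) = level_aut e n (a + c) + e n * level_aut e n (b + d) * rt n"
    unfolding xy by (rule level_aut_Suc[OF L_add L_add]) (use x y in simp_all)
  thus ?case using x y by (simp add: Suc.IH algebra_simps)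
qed simp

lemma level_aut_in_L: "range e \<subseteq> {1, -1} \<Longrightarrow> x \<in> L n \<Longrightarrow> level_aut e n x \<in> L n"
proof (induction n arbitrary: x)
  case (Suc n)
  obtain a b where x: "a \<in> L n" "b \<in> L n" "x = a + b * rt n" using Suc.prems(2) by (rule L_SucE)
  have "e n = 1 \<or> e n = -1" using Suc.prems(1) by auto
  hence "e n \<in> L n" by (auto intro: rat_in_L)
  hence "e n * level_aut e n b \<in> L n" using Suc x L_mult by blast
  thus ?case unfolding L_Suc_iff x(3) using x Suc by auto
qed simp

lemma level_aut_mult: "range e \<subseteq> {1, -1} \<Longrightarrow> x \<in> L n \<Longrightarrow> y \<in> L n \<Longrightarrow> level_aut e n (x * y) = level_aut e n x * level_aut e n y"
proof (induction n arbitrary: x y)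
  case (Suc n)
  obtain a b where x: "a \<in> L n" "b \<in> L n" "x = a + b * rt n" using Suc.prems(2) by (rule L_SucE)
  obtain c d where y: "c \<in> L n" "d \<in> L n" "y = c + d * rt n" using Suc.prems(3) by (rule L_SucE)
  have pn: "real (p n) \<in> \<rat>" by simp
  note pL = rat_in_L[OF pn, of n]
  have e: "e n * e n = 1" using Suc.prems(1) by (auto simp: image_subset_iff dest: spec[of _ n])
  have expand: "(a + b * r) * (c + d * r) = (a * c + b * d * (r * r)) + (a * d + b * c) * r"
    for a b c d r :: real by (simp add: algebra_simps)
  have "x * y = (a * c + b * d * real (p n)) + (a * d + b * c) * rt n"
    unfolding x y expand by simp
  hence "level_aut e (Suc n) (x * y)
    = level_aut e n (a * c + b * d * real (p n)) + e n * level_aut e n (a * d + b * c) * rt n"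
    using x y L_add L_mult pL by simp
  also have "\<dots> = (level_aut e n a * level_aut e n c + (e n * e n) * level_aut e n b * level_aut e n d * (rt n * rt n))
     + e n * (level_aut e n a * level_aut e n d + level_aut e n b * level_aut e n c) * rt n"
    using x y L_mult pL Suc.prems(1) by (simp add: level_aut_add Suc.IH level_aut_rat[OF pn] e)
  also have "\<dots> = (level_aut e n a + e n * level_aut e n b * rt n) * (level_aut e n c + e n * level_aut e n d * rt n)"
    unfolding expand by (simp add: algebra_simps)
  finally show ?case using x y by simp
qed simp

lemma level_aut_comp:
  "range d \<subseteq> {1, -1} \<Longrightarrow> x \<in> L n \<Longrightarrow> level_aut e n (level_aut d n x) = level_aut (\<lambda>i. e i * d i) n x"
proof (induction n arbitrary: x)
  case (Suc n)
  obtain a b where x: "a \<in> L n" "b \<in> L n" "x = a + b * rt n" using Suc.prems(2) by (rule L_SucE)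
  have "d n = 1 \<or> d n = -1" using Suc.prems(1) by auto
  hence "level_aut e n (d n * level_aut d n b) = d n * level_aut e n (level_aut d n b)"
    using level_aut_add[OF L_uminus, of "level_aut d n b" n "level_aut d n b" e] level_aut_in_L[OF Suc.prems(1) x(2)]
    by (auto simp: level_aut_zero)
  moreover have "d n \<in> L n" by (rule rat_in_L) (use \<open>d n = 1 \<or> d n = -1\<close> in auto)
  ultimately have "level_aut e (Suc n) (level_aut d n a + d n * level_aut d n b * rt n)
      = level_aut e n (level_aut d n a) + e n * (d n * level_aut e n (level_aut d n b)) * rt n"
    using x level_aut_in_L[OF Suc.prems(1)] L_mult by simp
  thus ?case using x Suc.IH[OF Suc.prems(1)] by (simp add: mult.assoc)
qed simp

lemma level_aut_trivial: "(\<And>i. i < n \<Longrightarrow> e i = 1) \<Longrightarrow> x \<in> L n \<Longrightarrow> level_aut e n x = x"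
proof (induction n arbitrary: x)
  case (Suc n)
  obtain a b where x: "a \<in> L n" "b \<in> L n" "x = a + b * rt n" using Suc.prems(2) by (rule L_SucE)
  thus ?case using Suc by simp
qed simp

lemma level_aut_rt: "i < n \<Longrightarrow> level_aut e n (rt i) = e i * rt i"
proof -
  assume i: "i < n"
  have "level_aut e (Suc i) (rt i) = e i * rt i"
    using level_aut_Suc[OF zero_in_L one_in_L, of e i] by (simp add: level_aut_zero level_aut_rat)
  moreover have "rt i \<in> L (Suc i)" by (rule rt_in_L) simp
  ultimately show ?thesis using level_aut_mono[of "Suc i" n "rt i" e] i by simp
qed

text \<open>The maps on the fields \<open>L n\<close> extend each other, so any level that contains the argument gives the
  same value; outside of \<open>K\<close> the value agrees with that of an extensional function.\<close>

definition sign_aut :: "(nat \<Rightarrow> real) \<Rightarrow> real \<Rightarrow> real" where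
  "sign_aut e x = (if x \<in> K_set p then level_aut e (LEAST n. x \<in> L n) x else undefined)"

lemma sign_aut_eq: "x \<in> L n \<Longrightarrow> sign_aut e x = level_aut e n x"
proof -
  assume x: "x \<in> L n"
  hence "x \<in> L (LEAST n. x \<in> L n)" "(LEAST n. x \<in> L n) \<le> n" by (auto intro: LeastI Least_le)
  thus ?thesis using level_aut_mono[of "LEAST n. x \<in> L n" n x e] x K_set_eq by (auto simp: sign_aut_def)
qed

lemma K_common: "x \<in> K_set p \<Longrightarrow> y \<in> K_set p \<Longrightarrow> \<exists>n. x \<in> L n \<and> y \<in> L n"
proof -
  assume "x \<in> K_set p" "y \<in> K_set p"
  then obtain m n where "x \<in> L m" "y \<in> L n" unfolding K_set_eq by (elim UN_E)
  thus ?thesis using L_mono[of m "max m n"] L_mono[of n "max m n"] by auto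
qed

lemma
  shows K_rat: "q \<in> \<rat> \<Longrightarrow> q \<in> K_set p" and K_rt: "rt i \<in> K_set p"
    and K_add: "x \<in> K_set p \<Longrightarrow> y \<in> K_set p \<Longrightarrow> x + y \<in> K_set p"
    and K_mult: "x \<in> K_set p \<Longrightarrow> y \<in> K_set p \<Longrightarrow> x * y \<in> K_set p"
    and K_uminus: "x \<in> K_set p \<Longrightarrow> - x \<in> K_set p"
    and K_inverse: "x \<in> K_set p \<Longrightarrow> inverse x \<in> K_set p"
proof -
  show "q \<in> K_set p" if "q \<in> \<rat>" using rat_in_L[OF that, of 0] by (auto simp: K_set_eq simp del: L.simps)
  show "rt i \<in> K_set p" using rt_in_L[of i "Suc i"] by (auto simp: K_set_eq)
  show "- x \<in> K_set p" "inverse x \<in> K_set p" if "x \<in> K_set p"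
    using that L_uminus[of x] L_inverse[of x] by (auto simp: K_set_eq)
  show "x + y \<in> K_set p" "x * y \<in> K_set p" if xy: "x \<in> K_set p" "y \<in> K_set p"
  proof -
    obtain n where "x \<in> L n" "y \<in> L n" using K_common[OF xy] by blast
    thus "x + y \<in> K_set p" "x * y \<in> K_set p"
      using L_add[of x n y] L_mult[of x n y] by (auto simp: K_set_eq)
  qed
qed

definition sgn_of :: "G \<Rightarrow> nat \<Rightarrow> real" where
  "sgn_of g i = (-1) powi (Poly_Mapping.lookup g i)"

lemma sgn_of_range: "range (sgn_of g) \<subseteq> {1, -1}"
proof -
  have "sgn_of g i = 1 \<or> sgn_of g i = -1" for i
    by (cases "even (Poly_Mapping.lookup g i)") (simp_all add: sgn_of_def)
  thus ?thesis by blast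
qed

lemma sign_aut_hom:
  assumes "x \<in> K_set p" "y \<in> K_set p" "range e \<subseteq> {1, -1}"
  shows "sign_aut e (x + y) = sign_aut e x + sign_aut e y"
    "sign_aut e (x * y) = sign_aut e x * sign_aut e y"
    "sign_aut e x \<in> K_set p"
proof -
  obtain n where n: "x \<in> L n" "y \<in> L n" using K_common[OF assms(1,2)] by blast
  show "sign_aut e (x + y) = sign_aut e x + sign_aut e y"
    "sign_aut e (x * y) = sign_aut e x * sign_aut e y"
    using n sign_aut_eq[of _ n e] L_add L_mult level_aut_add level_aut_mult[OF assms(3)] by auto
  show "sign_aut e x \<in> K_set p"
    using n sign_aut_eq[of _ n e] level_aut_in_L[OF assms(3) n(1)] K_set_eq by auto
qed

lemma sign_aut_comp:
  assumes "x \<in> K_set p" "range d \<subseteq> {1, -1}"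
  shows "sign_aut e (sign_aut d x) = sign_aut (\<lambda>i. e i * d i) x"
proof -
  obtain n where n: "x \<in> L n" using assms(1) K_set_eq by auto
  thus ?thesis using level_aut_comp[OF assms(2) n] level_aut_in_L[OF assms(2) n] by (simp add: sign_aut_eq[of _ n])
qed

lemma sign_aut_trivial: "x \<in> K_set p \<Longrightarrow> (\<And>i. e i = 1) \<Longrightarrow> sign_aut e x = x"
  using level_aut_trivial sign_aut_eq K_set_eq by auto

text \<open>This gives the uniqueness in the definition of the action.\<close>

lemma hom_on_K_determined:
  assumes hom: "\<And>\<phi>. \<phi> \<in> {\<sigma>, \<tau>} \<Longrightarrow> \<phi> \<in> ring_hom (K_ring p) (K_ring p)"
    and rat: "\<And>q. q \<in> \<rat> \<Longrightarrow> \<sigma> q = \<tau> q" and rt: "\<And>i. \<sigma> (rt i) = \<tau> (rt i)" and x: "x \<in> K_set p"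
  shows "\<sigma> x = \<tau> x"
proof -
  have hom': "\<phi> (a + b) = \<phi> a + \<phi> b" "\<phi> (a * b) = \<phi> a * \<phi> b"
    if "\<phi> \<in> {\<sigma>, \<tau>}" "a \<in> K_set p" "b \<in> K_set p" for a b \<phi>
    using ring_hom_memE(2,3)[OF hom[OF that(1)], of a b] that by (simp_all add: K_ring_def)
  have "x \<in> L n \<Longrightarrow> \<sigma> x = \<tau> x" for n
  proof (induction n arbitrary: x)
    case (Suc n)
    obtain a b where ab: "a \<in> L n" "b \<in> L n" "x = a + b * rt n" using Suc.prems by (rule L_SucE)
    hence "a \<in> K_set p" "b \<in> K_set p" unfolding K_set_eq by blast+
    hence "\<phi> (a + b * rt n) = \<phi> a + \<phi> b * \<phi> (rt n)" if "\<phi> \<in> {\<sigma>, \<tau>}" for \<phi>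
      by (simp only: hom'[OF that] K_rt K_mult)
    from this[of \<sigma>] this[of \<tau>] show ?case using ab Suc.IH rt by simp
  qed (use rat in simp)
  thus ?thesis using x K_set_eq by auto
qed

text \<open>The sign change is an automorphism since it is its own inverse, and it is the only one because the
  square roots generate \<open>K\<close> over \<open>\<rat>\<close>.\<close>

lemma act_eq: "act p g = sign_aut (sgn_of g)"
  unfolding act_def
proof (rule the_equality)
  let ?s = "sign_aut (sgn_of g)"
  have inv: "?s (?s x) = x" if "x \<in> K_set p" for x
  proof -
    have "sgn_of g i * sgn_of g i = 1" for i using sgn_of_range[of g] by (auto simp: image_subset_iff dest: spec[of _ i])
    thus ?thesis using sign_aut_comp[OF that sgn_of_range] sign_aut_trivial[OF that] by simp
  qed
  have one: "?s q = q" if "q \<in> \<rat>" for q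
    using sign_aut_eq[of q 0] that by simp
  have "bij_betw ?s (K_set p) (K_set p)"
    by (rule bij_betw_byWitness[where f' = ?s]) (use inv sign_aut_hom(3)[OF _ _ sgn_of_range] in auto)
  moreover have "?s \<in> ring_hom (K_ring p) (K_ring p)"
    using sign_aut_hom[OF _ _ sgn_of_range] one[of 1] by (auto simp: ring_hom_def K_ring_def)
  ultimately have iso: "?s \<in> ring_iso (K_ring p) (K_ring p)"
    by (simp add: ring_iso_def K_ring_def)
  have ext: "?s \<in> extensional (K_set p)" by (simp add: extensional_def sign_aut_def)
  have rts: "?s (rt i) = (-1) powi (Poly_Mapping.lookup g i) * rt i" for i
    using sign_aut_eq[OF rt_in_L[of i "Suc i"]] level_aut_rt[of i "Suc i"] by (simp add: sgn_of_def)
  show "?s \<in> extensional (K_set p) \<and> ?s \<in> ring_iso (K_ring p) (K_ring p) \<and> (\<forall>q\<in>\<rat>. ?s q = q) \<and>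
    (\<forall>i. ?s (rt i) = (-1) powi (Poly_Mapping.lookup g i) * rt i)"
    using iso ext rts one by blast
  fix \<sigma>
  assume \<sigma>: "\<sigma> \<in> extensional (K_set p) \<and> \<sigma> \<in> ring_iso (K_ring p) (K_ring p) \<and> (\<forall>q\<in>\<rat>. \<sigma> q = q) \<and>
    (\<forall>i. \<sigma> (rt i) = (-1) powi (Poly_Mapping.lookup g i) * rt i)"
  show "\<sigma> = ?s"
  proof (rule extensionalityI[OF _ ext])
    show "\<sigma> \<in> extensional (K_set p)" using \<sigma> by blast
    show "\<sigma> x = ?s x" if "x \<in> K_set p" for x
      by (rule hom_on_K_determined[OF _ _ _ that]) (use \<sigma> iso one rts in \<open>auto simp: ring_iso_def\<close>)
  qed
qed

lemma act_closed: "c \<in> K_set p \<Longrightarrow> act p g c \<in> K_set p"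
  and act_add: "c \<in> K_set p \<Longrightarrow> d \<in> K_set p \<Longrightarrow> act p g (c + d) = act p g c + act p g d"
  and act_mult: "c \<in> K_set p \<Longrightarrow> d \<in> K_set p \<Longrightarrow> act p g (c * d) = act p g c * act p g d"
  unfolding act_eq using sign_aut_hom[OF _ _ sgn_of_range] by auto

lemma act_rat: "q \<in> \<rat> \<Longrightarrow> act p g q = q"
  unfolding act_eq using sign_aut_eq[of q 0] by simp

lemma act_rt: "act p g (rt i) = sgn_of g i * rt i"
  unfolding act_eq using sign_aut_eq[OF rt_in_L[of i "Suc i"]] level_aut_rt[of i "Suc i"] by simp

lemma act_act: "c \<in> K_set p \<Longrightarrow> act p g (act p h c) = act p (g + h) c"
  unfolding act_eq using sign_aut_comp[OF _ sgn_of_range]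
  by (simp add: sgn_of_def[abs_def] lookup_add power_int_add)

lemma act_trivial: "c \<in> K_set p \<Longrightarrow> (\<And>i. act p g (rt i) = rt i) \<Longrightarrow> act p g c = c"
proof -
  assume c: "c \<in> K_set p" and fixed: "\<And>i. act p g (rt i) = rt i"
  have "sgn_of g i = 1" for i using fixed[of i] rt_pos[of i] by (simp add: act_rt)
  thus ?thesis unfolding act_eq by (rule sign_aut_trivial[OF c])
qed

lemma act_zero: "c \<in> K_set p \<Longrightarrow> act p 0 c = c"
  by (rule act_trivial) (simp_all add: act_rt sgn_of_def)

lemma act_sum: "(\<And>i. i \<in> I \<Longrightarrow> f i \<in> K_set p) \<Longrightarrow> act p g (sum f I) = (\<Sum>i\<in>I. act p g (f i)) \<and> sum f I \<in> K_set p"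
  by (induction I rule: infinite_finite_induct) (auto simp: act_rat act_add K_rat K_add)

lemma sgn_of_neg_single: "sgn_of (- Poly_Mapping.single i 1) j = (if i = j then -1 else 1)"
  by (simp add: sgn_of_def lookup_single power_int_minus)

text \<open>If \<open>a + b \<surd>p\<^sub>n\<close> is fixed by the sign change at \<open>n\<close>, then \<open>b = 0\<close>; so a common fixed element descends
  from each \<open>L (n + 1)\<close> to \<open>L n\<close> and finally to \<open>\<rat>\<close>.\<close>

lemma act_fixed_rational:
  assumes "c \<in> K_set p" "\<And>i. act p (- Poly_Mapping.single i 1) c = c"
  shows "c \<in> \<rat>"
proof -
  obtain n where "c \<in> L n" using assms(1) K_set_eq by auto
  thus ?thesis using assms(2)
  proof (induction n arbitrary: c)
    case (Suc n)
    obtain a b where ab: "a \<in> L n" "b \<in> L n" "c = a + b * rt n" using Suc.prems(1) by (rule L_SucE)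
    let ?e = "sgn_of (- Poly_Mapping.single n 1)"
    have "level_aut ?e n x = x" if "x \<in> L n" for x
      by (rule level_aut_trivial[OF _ that]) (simp add: sgn_of_neg_single)
    hence "a - b * rt n = a + b * rt n"
      using Suc.prems(2)[of n] sign_aut_eq[OF Suc.prems(1), of ?e] ab
      by (simp add: act_eq sgn_of_neg_single)
    hence "b = 0" using rt_pos[of n] by simp
    thus ?case using Suc ab by simp
  qed simp
qed

end

section \<open>Well-ordered subsets of an ordered group\<close>

text \<open>Well-ordering in terms of least elements, without an explicit relation.\<close>

definition wo :: "'a :: linorder set \<Rightarrow> bool" where
  "wo A \<longleftrightarrow> (\<forall>B\<subseteq>A. B \<noteq> {} \<longrightarrow> (\<exists>m\<in>B. \<forall>b\<in>B. m \<le> b))"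

lemma woD: "wo A \<Longrightarrow> B \<subseteq> A \<Longrightarrow> B \<noteq> {} \<Longrightarrow> \<exists>m\<in>B. \<forall>b\<in>B. m \<le> b"
  unfolding wo_def by blast

lemma well_order_on_iff_wo:
  fixes A :: "'a :: linorder set"
  shows "well_order_on A {(g, h). g \<in> A \<and> h \<in> A \<and> g \<le> h} \<longleftrightarrow> wo A"
proof
  let ?r = "{(g, h). g \<in> A \<and> h \<in> A \<and> g \<le> h}"
  assume "well_order_on A ?r"
  hence wf: "wf (?r - Id)" by (simp add: well_order_on_def)
  show "wo A" unfolding wo_def
  proof (intro allI impI)
    fix B assume B: "B \<subseteq> A" "B \<noteq> {}"
    then obtain x where "x \<in> B" by blast
    then obtain z where z: "z \<in> B" "\<And>y. (y, z) \<in> ?r - Id \<Longrightarrow> y \<notin> B"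
      by (rule wfE_min[OF wf]) blast
    have "z \<le> b" if "b \<in> B" for b
    proof (rule ccontr)
      assume "\<not> z \<le> b"
      hence "b \<le> z" "b \<noteq> z" by auto
      thus False using z(2)[of b] that z(1) B(1) by auto
    qed
    thus "\<exists>m\<in>B. \<forall>b\<in>B. m \<le> b" using z(1) by blast
  qed
next
  let ?r = "{(g, h). g \<in> A \<and> h \<in> A \<and> g \<le> h}"
  assume wo: "wo A"
  have "wf (?r - Id)"
  proof (rule wfI_min)
    fix x :: 'a and Q assume x: "x \<in> Q"
    show "\<exists>z\<in>Q. \<forall>y. (y, z) \<in> ?r - Id \<longrightarrow> y \<notin> Q"
    proof (cases "Q \<inter> A = {}")
      case True
      thus ?thesis using x by (intro bexI[of _ x]) auto
    next
      case False
      then obtain m where "m \<in> Q \<inter> A" "\<forall>b\<in>Q \<inter> A. m \<le> b" using woD[OF wo, of "Q \<inter> A"] by auto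
      thus ?thesis by (intro bexI[of _ m]) force+
    qed
  qed
  moreover have "linear_order_on A ?r"
    by (auto simp: linear_order_on_def partial_order_on_def preorder_on_def refl_on_def trans_def antisym_def total_on_def)
  ultimately show "well_order_on A ?r" by (simp add: well_order_on_def)
qed

lemma wo_subset: "wo A \<Longrightarrow> B \<subseteq> A \<Longrightarrow> wo B"
  unfolding wo_def by (meson subset_trans)

lemma wo_empty: "wo {}" and wo_singleton: "wo {x}"
  by (auto simp: wo_def)

lemma wo_Un:
  assumes "wo A" "wo B"
  shows "wo (A \<union> B)"
  unfolding wo_def
proof (intro allI impI)
  fix S assume S: "S \<subseteq> A \<union> B" "S \<noteq> {}"
  show "\<exists>m\<in>S. \<forall>b\<in>S. m \<le> b"
  proof (cases "S \<inter> A = {} \<or> S \<inter> B = {}")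
    case True
    hence "S \<subseteq> B \<or> S \<subseteq> A" using S by blast
    thus ?thesis using woD assms S(2) by metis
  next
    case False
    then obtain m n where "m \<in> S \<inter> A" "\<forall>b\<in>S \<inter> A. m \<le> b" "n \<in> S \<inter> B" "\<forall>b\<in>S \<inter> B. n \<le> b"
      using woD[OF assms(1), of "S \<inter> A"] woD[OF assms(2), of "S \<inter> B"] by (metis inf_le2)
    hence "min m n \<le> b" if "b \<in> S" for b
      using that S(1) by (metis IntI UnE min.coboundedI1 min.coboundedI2 subsetD)
    moreover have "min m n \<in> S" using \<open>m \<in> S \<inter> A\<close> \<open>n \<in> S \<inter> B\<close> by (auto simp: min_def)
    ultimately show ?thesis by blast
  qed
qed

text \<open>Otherwise take the least \<open>b\<close> with infinitely many elements below it. The greatest element strictly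
  below \<open>b\<close> has infinitely many elements below it as well.\<close>

lemma finite_if_wo_both_ways:
  assumes up: "wo U" and down: "\<And>B. B \<subseteq> U \<Longrightarrow> B \<noteq> {} \<Longrightarrow> \<exists>m\<in>B. \<forall>b\<in>B. b \<le> m"
  shows "finite U"
proof (rule ccontr)
  assume inf: "infinite U"
  let ?B = "{u \<in> U. infinite {w \<in> U. w \<le> u}}"
  obtain m where "m \<in> U" "\<forall>b\<in>U. b \<le> m" using down[of U] inf by auto
  hence "{w \<in> U. w \<le> m} = U" by auto
  hence "?B \<noteq> {}" using inf \<open>m \<in> U\<close> by auto
  then obtain b where b: "b \<in> ?B" "\<forall>c\<in>?B. b \<le> c" using woD[OF up, of ?B] by auto
  let ?C = "{w \<in> U. w < b}"
  have eq: "{w \<in> U. w \<le> b} = insert b ?C" using b by auto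
  hence infC: "infinite ?C" using b by auto
  then obtain c where c: "c \<in> ?C" "\<forall>w\<in>?C. w \<le> c" using down[of ?C] infinite_imp_nonempty[OF infC] by auto
  hence "?C \<subseteq> {w \<in> U. w \<le> c}" by auto
  hence "infinite {w \<in> U. w \<le> c}" using infC finite_subset by blast
  hence "c \<in> ?B" using c by auto
  hence "b \<le> c" using b(2) by blast
  thus False using c(1) by auto
qed

lemma no_decreasing_sequence_in_wo:
  assumes "wo A" "range f \<subseteq> A" "\<And>m n :: nat. m < n \<Longrightarrow> f n < f m"
  shows False
proof -
  obtain m where "\<And>n. f m \<le> f n" using woD[OF assms(1,2)] by auto
  thus False using assms(3)[of m "Suc m"] leD by blast
qed

definition psum :: "'a :: ab_group_add set \<Rightarrow> 'a set \<Rightarrow> 'a set" where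
  "psum A B = {u + v | u v. u \<in> A \<and> v \<in> B}"

definition fibre :: "'a :: ab_group_add set \<Rightarrow> 'a set \<Rightarrow> 'a \<Rightarrow> ('a \<times> 'a) set" where
  "fibre A B g = {(u, v). u \<in> A \<and> v \<in> B \<and> u + v = g}"

text \<open>As \<open>u\<close> runs through the first components, \<open>v = g - u\<close> runs through a well-ordered set in reverse, so
  the first components are well-ordered in both directions.\<close>

lemma finite_fibre:
  fixes A B :: "'a :: linordered_ab_group_add set"
  assumes "wo A" "wo B"
  shows "finite (fibre A B g)"
proof -
  let ?U = "{u \<in> A. g - u \<in> B}"
  have "finite ?U"
  proof (rule finite_if_wo_both_ways)
    show "wo ?U" by (rule wo_subset[OF assms(1)]) auto
    fix S assume S: "S \<subseteq> ?U" "S \<noteq> {}"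
    then obtain v where v: "v \<in> (\<lambda>u. g - u) ` S" "\<forall>b\<in>(\<lambda>u. g - u) ` S. v \<le> b"
      using woD[OF assms(2), of "(\<lambda>u. g - u) ` S"] by blast
    then obtain m where "m \<in> S" "v = g - m" by blast
    thus "\<exists>m\<in>S. \<forall>b\<in>S. b \<le> m" using v by (intro bexI[of _ m]) auto
  qed
  moreover have "fibre A B g \<subseteq> (\<lambda>u. (u, g - u)) ` ?U" by (auto simp: fibre_def)
  ultimately show ?thesis using finite_surj by blast
qed

text \<open>From a strictly decreasing sequence \<open>a\<^sub>n + b\<^sub>n\<close> pick a subsequence along which \<open>a\<^sub>n\<close> is monotone.
  If \<open>a\<^sub>n\<close> increases, then \<open>b\<^sub>n\<close> strictly decreases; if \<open>a\<^sub>n\<close> decreases, it is eventually constant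
  and again \<open>b\<^sub>n\<close> strictly decreases.\<close>

lemma wo_psum:
  fixes A B :: "'a :: linordered_ab_group_add set"
  assumes "wo A" "wo B"
  shows "wo (psum A B)"
proof (rule ccontr)
  assume "\<not> wo (psum A B)"
  then obtain S where S: "S \<subseteq> psum A B" "S \<noteq> {}" "\<forall>m\<in>S. \<exists>b\<in>S. b < m"
    unfolding wo_def by (meson not_le)
  then obtain x0 where "x0 \<in> S" by blast
  have "\<exists>c. \<forall>n. c n \<in> S \<and> c (Suc n) < c n"
    by (rule dependent_nat_choice) (use S \<open>x0 \<in> S\<close> in blast)+
  then obtain c where c: "\<And>n. c n \<in> S" "\<And>n. c (Suc n) < c n" by blast
  have decr: "c n < c m" if "m < n" for m n using that c(2) by (rule lift_Suc_mono_less[where f = "\<lambda>n. - c n", simplified, rotated])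
  have "\<forall>n. \<exists>u v. u \<in> A \<and> v \<in> B \<and> c n = u + v" using c(1) S(1) by (force simp: psum_def)
  then obtain a b where ab: "\<And>n. a n \<in> A" "\<And>n. b n \<in> B" "\<And>n. c n = a n + b n" by metis
  obtain f where f: "strict_mono f" "monoseq (\<lambda>n. a (f n))" using seq_monosub by blast
  consider "\<And>m n. m \<le> n \<Longrightarrow> a (f m) \<le> a (f n)" | "\<And>m n. m \<le> n \<Longrightarrow> a (f n) \<le> a (f m)"
    using f(2) unfolding monoseq_def by blast
  thus False
  proof cases
    case 1
    have "b (f n) < b (f m)" if "m < n" for m n
    proof -
      have "a (f n) + b (f n) < a (f m) + b (f m)"
        using decr[of "f m" "f n"] strict_monoD[OF f(1) that] by (simp add: ab(3))
      also have "\<dots> \<le> a (f n) + b (f m)" using 1[of m n] that by simp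
      finally show ?thesis by simp
    qed
    thus False using no_decreasing_sequence_in_wo[OF assms(2), of "\<lambda>n. b (f n)"] ab(2) by blast
  next
    case 2
    obtain N where N: "\<And>n. a (f N) \<le> a (f n)"
      using woD[OF assms(1), of "range (\<lambda>n. a (f n))"] ab(1) by auto
    have const: "a (f n) = a (f N)" if "N \<le> n" for n using 2[OF that] N by (simp add: antisym)
    have "b (f (N + n)) < b (f (N + m))" if "m < n" for m n
      using decr[of "f (N + m)" "f (N + n)"] strict_monoD[OF f(1), of "N + m" "N + n"] that
        const[of "N + m"] const[of "N + n"] by (simp add: ab(3))
    thus False using no_decreasing_sequence_in_wo[OF assms(2), of "\<lambda>n. b (f (N + n))"] ab(2) by blast
  qed
qed

section \<open>The ring of twisted series\<close>

context sqrt_tower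
begin

abbreviation Dp where "Dp \<equiv> D p"

lemma D_add: "(a \<oplus>\<^bsub>Dp\<^esub> b) = (\<lambda>g. a g + b g)" and D_zero: "\<zero>\<^bsub>Dp\<^esub> = (\<lambda>_. 0)"
  and D_one: "\<one>\<^bsub>Dp\<^esub> = const 1"
  by (simp_all add: D_def)

lemma D_carrier: "a \<in> carrier Dp \<longleftrightarrow> (\<forall>g. a g \<in> K_set p) \<and> wo (supp a)"
  by (auto simp: D_def well_order_on_iff_wo)

lemma D_carrierI:
  assumes "\<And>g. a g \<in> K_set p" "wo A" "\<And>g. a g \<noteq> 0 \<Longrightarrow> g \<in> A"
  shows "a \<in> carrier Dp"
  using assms wo_subset[of A "supp a"] by (auto simp: D_carrier supp_def)

lemma D_K: "a \<in> carrier Dp \<Longrightarrow> a g \<in> K_set p" and D_wo: "a \<in> carrier Dp \<Longrightarrow> wo (supp a)"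
  by (simp_all add: D_carrier)

lemma act_0 [simp]: "act p g 0 = 0" and act_1 [simp]: "act p g 1 = 1"
  by (simp_all add: act_rat)

text \<open>The freedom to sum over larger well-ordered sets than the supports lets several products be expanded
  over the same index set, which the distributive and associative laws require.\<close>

lemma D_mult:
  assumes "wo A" "wo B" "supp a \<subseteq> A" "supp b \<subseteq> B"
  shows "(a \<otimes>\<^bsub>Dp\<^esub> b) g = (\<Sum>(u, v)\<in>fibre A B g. a u * act p u (b v))"
proof -
  have "(a \<otimes>\<^bsub>Dp\<^esub> b) g = (\<Sum>(u, v)\<in>fibre (supp a) (supp b) g. a u * act p u (b v))"
    by (simp add: D_def fibre_def)
  also have "\<dots> = (\<Sum>(u, v)\<in>fibre A B g. a u * act p u (b v))"
    by (rule sum.mono_neutral_left[OF finite_fibre[OF assms(1,2)]])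
       (use assms(3,4) in \<open>auto simp: fibre_def supp_def\<close>)
  finally show ?thesis .
qed

lemmas D_mult_supp = D_mult[OF D_wo D_wo order.refl order.refl]

lemma K_sum: "(\<And>i. i \<in> I \<Longrightarrow> f i \<in> K_set p) \<Longrightarrow> sum f I \<in> K_set p"
  using act_sum by blast

lemma summand_in_K:
  "a \<in> carrier Dp \<Longrightarrow> b \<in> carrier Dp \<Longrightarrow> a u * act p u (b v) \<in> K_set p"
  by (intro K_mult act_closed D_K)

lemma supp_mult:
  assumes "a \<in> carrier Dp" "b \<in> carrier Dp"
  shows "supp (a \<otimes>\<^bsub>Dp\<^esub> b) \<subseteq> psum (supp a) (supp b)"
proof
  fix g assume "g \<in> supp (a \<otimes>\<^bsub>Dp\<^esub> b)"
  hence "fibre (supp a) (supp b) g \<noteq> {}" using D_mult_supp[OF assms, of g] by (auto simp: supp_def)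
  thus "g \<in> psum (supp a) (supp b)" by (auto simp: fibre_def psum_def)
qed

lemma D_mult_closed:
  assumes "a \<in> carrier Dp" "b \<in> carrier Dp"
  shows "a \<otimes>\<^bsub>Dp\<^esub> b \<in> carrier Dp"
  unfolding D_carrier
proof
  show "wo (supp (a \<otimes>\<^bsub>Dp\<^esub> b))"
    by (rule wo_subset[OF wo_psum supp_mult]) (use assms D_wo in auto)
  show "\<forall>g. (a \<otimes>\<^bsub>Dp\<^esub> b) g \<in> K_set p"
    unfolding D_mult_supp[OF assms] using summand_in_K[OF assms] by (auto intro!: K_sum)
qed

text \<open>Both sides are the sum of \<open>a\<^sub>u b\<^sub>v\<^sup>u c\<^sub>z\<^sup>u\<^sup>+\<^sup>v\<close> over the triples with
  \<open>u + v + z = g\<close>, grouped by \<open>u + v\<close> on the left and by \<open>v + z\<close> on the right.\<close>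

lemma D_mult_assoc:
  assumes a: "a \<in> carrier Dp" and b: "b \<in> carrier Dp" and c: "c \<in> carrier Dp"
  shows "a \<otimes>\<^bsub>Dp\<^esub> b \<otimes>\<^bsub>Dp\<^esub> c = a \<otimes>\<^bsub>Dp\<^esub> (b \<otimes>\<^bsub>Dp\<^esub> c)"
proof
  fix g
  let ?A = "supp a" and ?B = "supp b" and ?C = "supp c"
  let ?f = "\<lambda>u v z. a u * act p u (b v) * act p (u + v) (c z)"
  note wos = D_wo[OF a] D_wo[OF b] D_wo[OF c]
  note woAB = wo_psum[OF wos(1,2)] and woBC = wo_psum[OF wos(2,3)]
  have fin: "finite (fibre ?A ?B w)" "finite (fibre ?B ?C w)" for w
    using finite_fibre wos by auto
  have "(a \<otimes>\<^bsub>Dp\<^esub> b \<otimes>\<^bsub>Dp\<^esub> c) g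
      = (\<Sum>(w, z)\<in>fibre (psum ?A ?B) ?C g. (a \<otimes>\<^bsub>Dp\<^esub> b) w * act p w (c z))"
    by (rule D_mult[OF woAB wos(3) supp_mult[OF a b] order.refl])
  also have "\<dots> = (\<Sum>(w, z)\<in>fibre (psum ?A ?B) ?C g. \<Sum>(u, v)\<in>fibre ?A ?B w. ?f u v z)"
  proof (intro sum.cong refl, clarify)
    fix w z
    have "(a \<otimes>\<^bsub>Dp\<^esub> b) w * act p w (c z) = (\<Sum>(u, v)\<in>fibre ?A ?B w. a u * act p u (b v) * act p w (c z))"
      unfolding D_mult_supp[OF a b] sum_distrib_right by (simp add: case_prod_unfold)
    also have "\<dots> = (\<Sum>(u, v)\<in>fibre ?A ?B w. ?f u v z)"
      by (intro sum.cong refl) (auto simp: fibre_def)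
    finally show "(a \<otimes>\<^bsub>Dp\<^esub> b) w * act p w (c z) = (\<Sum>(u, v)\<in>fibre ?A ?B w. ?f u v z)" .
  qed
  also have "\<dots> = (\<Sum>((w, z), (u, v))\<in>Sigma (fibre (psum ?A ?B) ?C g) (\<lambda>(w, z). fibre ?A ?B w). ?f u v z)"
    using finite_fibre[OF woAB wos(3)] fin(1)
    by (subst sum.Sigma[symmetric]) (auto simp: case_prod_unfold)
  also have "\<dots> = (\<Sum>((u, y), (v, z))\<in>Sigma (fibre ?A (psum ?B ?C) g) (\<lambda>(u, y). fibre ?B ?C y). ?f u v z)"
    by (rule sum.reindex_bij_witness[where i = "\<lambda>((u, y), (v, z)). ((u + v, z), (u, v))"
          and j = "\<lambda>((w, z), (u, v)). ((u, v + z), (v, z))"])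
       (auto simp: fibre_def psum_def add.assoc)
  also have "\<dots> = (\<Sum>(u, y)\<in>fibre ?A (psum ?B ?C) g. \<Sum>(v, z)\<in>fibre ?B ?C y. ?f u v z)"
    using finite_fibre[OF wos(1) woBC] fin(2)
    by (subst sum.Sigma[symmetric]) (auto simp: case_prod_unfold)
  also have "\<dots> = (\<Sum>(u, y)\<in>fibre ?A (psum ?B ?C) g. a u * act p u ((b \<otimes>\<^bsub>Dp\<^esub> c) y))"
  proof (intro sum.cong refl, clarify)
    fix u y
    have "act p u ((b \<otimes>\<^bsub>Dp\<^esub> c) y) = (\<Sum>(v, z)\<in>fibre ?B ?C y. act p u (b v * act p v (c z)))"
      unfolding D_mult_supp[OF b c] using act_sum[of "fibre ?B ?C y" "\<lambda>(v, z). b v * act p v (c z)" u]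
        summand_in_K[OF b c] by (simp add: case_prod_unfold)
    also have "\<dots> = (\<Sum>(v, z)\<in>fibre ?B ?C y. act p u (b v) * act p (u + v) (c z))"
      using D_K[OF b] D_K[OF c] by (simp add: act_mult act_closed act_act)
    finally show "(\<Sum>(v, z)\<in>fibre ?B ?C y. ?f u v z) = a u * act p u ((b \<otimes>\<^bsub>Dp\<^esub> c) y)"
      by (simp add: sum_distrib_left case_prod_unfold mult.assoc)
  qed
  also have "\<dots> = (a \<otimes>\<^bsub>Dp\<^esub> (b \<otimes>\<^bsub>Dp\<^esub> c)) g"
    by (rule D_mult[OF wos(1) woBC order.refl supp_mult[OF b c], symmetric])
  finally show "(a \<otimes>\<^bsub>Dp\<^esub> b \<otimes>\<^bsub>Dp\<^esub> c) g = (a \<otimes>\<^bsub>Dp\<^esub> (b \<otimes>\<^bsub>Dp\<^esub> c)) g" .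
qed

lemma D_add_closed: "a \<in> carrier Dp \<Longrightarrow> b \<in> carrier Dp \<Longrightarrow> a \<oplus>\<^bsub>Dp\<^esub> b \<in> carrier Dp"
  by (rule D_carrierI[where A = "supp a \<union> supp b"]) (auto simp: D_add D_carrier K_add wo_Un supp_def)

lemma D_uminus_closed: "a \<in> carrier Dp \<Longrightarrow> (\<lambda>g. - a g) \<in> carrier Dp"
  by (rule D_carrierI[where A = "supp a"]) (auto simp: D_carrier K_uminus supp_def)

definition hahn_monom :: "real \<Rightarrow> G \<Rightarrow> G \<Rightarrow> real" where
  "hahn_monom c g = (\<lambda>h. if h = g then c else 0)"

lemma const_eq_hahn_monom: "const c = hahn_monom c 0"
  by (simp add: const_def hahn_monom_def)

lemma supp_hahn_monom: "supp (hahn_monom c g) \<subseteq> {g}"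
  by (auto simp: supp_def hahn_monom_def)

lemma hahn_monom_closed: "c \<in> K_set p \<Longrightarrow> hahn_monom c g \<in> carrier Dp"
  by (rule D_carrierI[where A = "{g}"]) (auto simp: hahn_monom_def wo_singleton K_rat split: if_splits)

lemma hahn_monom_mult_left:
  assumes "b \<in> carrier Dp"
  shows "(hahn_monom c g \<otimes>\<^bsub>Dp\<^esub> b) h = c * act p g (b (h - g))"
proof -
  have "(hahn_monom c g \<otimes>\<^bsub>Dp\<^esub> b) h = (\<Sum>(u, v)\<in>fibre {g} (supp b) h. hahn_monom c g u * act p u (b v))"
    by (rule D_mult[OF wo_singleton D_wo[OF assms] supp_hahn_monom order.refl])
  also have "\<dots> = (\<Sum>(u, v)\<in>{(g, h - g)}. hahn_monom c g u * act p u (b v))"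
    by (rule sum.mono_neutral_left) (auto simp: fibre_def supp_def)
  finally show ?thesis by (simp add: hahn_monom_def)
qed

lemma hahn_monom_mult_right:
  assumes "a \<in> carrier Dp"
  shows "(a \<otimes>\<^bsub>Dp\<^esub> hahn_monom c g) h = a (h - g) * act p (h - g) c"
proof -
  have "(a \<otimes>\<^bsub>Dp\<^esub> hahn_monom c g) h = (\<Sum>(u, v)\<in>fibre (supp a) {g} h. a u * act p u (hahn_monom c g v))"
    by (rule D_mult[OF D_wo[OF assms] wo_singleton order.refl supp_hahn_monom])
  also have "\<dots> = (\<Sum>(u, v)\<in>{(h - g, g)}. a u * act p u (hahn_monom c g v))"
    by (rule sum.mono_neutral_left) (auto simp: fibre_def supp_def)
  finally show ?thesis by (simp add: hahn_monom_def)
qed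

lemma D_distrib:
  assumes a: "a \<in> carrier Dp" and b: "b \<in> carrier Dp" and c: "c \<in> carrier Dp"
  shows "(a \<oplus>\<^bsub>Dp\<^esub> b) \<otimes>\<^bsub>Dp\<^esub> c = a \<otimes>\<^bsub>Dp\<^esub> c \<oplus>\<^bsub>Dp\<^esub> b \<otimes>\<^bsub>Dp\<^esub> c"
    and "c \<otimes>\<^bsub>Dp\<^esub> (a \<oplus>\<^bsub>Dp\<^esub> b) = c \<otimes>\<^bsub>Dp\<^esub> a \<oplus>\<^bsub>Dp\<^esub> c \<otimes>\<^bsub>Dp\<^esub> b"
proof -
  let ?U = "supp a \<union> supp b"
  have U: "wo ?U" and C: "wo (supp c)" using wo_Un D_wo a b c by auto
  have sub: "supp (a \<oplus>\<^bsub>Dp\<^esub> b) \<subseteq> ?U" "supp a \<subseteq> ?U" "supp b \<subseteq> ?U" by (auto simp: supp_def D_add)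
  note l = D_mult[OF U C _ order.refl] and r = D_mult[OF C U order.refl]
  show "(a \<oplus>\<^bsub>Dp\<^esub> b) \<otimes>\<^bsub>Dp\<^esub> c = a \<otimes>\<^bsub>Dp\<^esub> c \<oplus>\<^bsub>Dp\<^esub> b \<otimes>\<^bsub>Dp\<^esub> c"
    by (rule ext, subst D_add, simp only: l[OF sub(1)] l[OF sub(2)] l[OF sub(3)])
       (simp add: D_add sum.distrib[symmetric] case_prod_unfold distrib_right)
  show "c \<otimes>\<^bsub>Dp\<^esub> (a \<oplus>\<^bsub>Dp\<^esub> b) = c \<otimes>\<^bsub>Dp\<^esub> a \<oplus>\<^bsub>Dp\<^esub> c \<otimes>\<^bsub>Dp\<^esub> b"
    by (rule ext, subst D_add, simp only: r[OF sub(1)] r[OF sub(2)] r[OF sub(3)])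
       (simp add: D_add sum.distrib[symmetric] case_prod_unfold distrib_left act_add D_K[OF a] D_K[OF b])
qed

lemma D_one_closed: "\<one>\<^bsub>Dp\<^esub> \<in> carrier Dp"
  unfolding D_one const_eq_hahn_monom by (rule hahn_monom_closed) (simp add: K_rat)

lemma D_ring: "ring Dp"
proof (rule ringI)
  show "abelian_group Dp"
  proof (rule abelian_groupI)
    show "\<zero>\<^bsub>Dp\<^esub> \<in> carrier Dp" by (auto simp: D_zero D_carrier K_rat supp_def wo_empty)
    show "\<exists>y\<in>carrier Dp. y \<oplus>\<^bsub>Dp\<^esub> a = \<zero>\<^bsub>Dp\<^esub>" if "a \<in> carrier Dp" for a
      by (rule bexI[OF _ D_uminus_closed[OF that]]) (simp add: D_add D_zero)
  qed (simp_all add: D_add_closed, simp_all add: D_add D_zero algebra_simps)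
  show "monoid Dp"
  proof (rule monoidI)
    fix a assume a: "a \<in> carrier Dp"
    show "\<one>\<^bsub>Dp\<^esub> \<otimes>\<^bsub>Dp\<^esub> a = a" "a \<otimes>\<^bsub>Dp\<^esub> \<one>\<^bsub>Dp\<^esub> = a"
      unfolding D_one const_eq_hahn_monom using hahn_monom_mult_left[OF a] hahn_monom_mult_right[OF a] D_K[OF a]
      by (auto simp: act_zero)
  qed (simp_all add: D_mult_closed D_mult_assoc D_one_closed)
qed (simp_all add: D_distrib)

end

section \<open>Inverses of twisted series\<close>

context sqrt_tower
begin

lemma D_minus:
  assumes "a \<in> carrier Dp" "b \<in> carrier Dp"
  shows "a \<ominus>\<^bsub>Dp\<^esub> b = (\<lambda>g. a g - b g)"
proof -
  interpret ring Dp by (rule D_ring)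
  have "\<ominus>\<^bsub>Dp\<^esub> b = (\<lambda>g. - b g)"
    by (rule minus_equality) (simp_all add: D_add D_zero assms D_uminus_closed)
  thus ?thesis by (simp add: minus_eq D_add)
qed

text \<open>The sum of the lower bounds \<open>v\<close> and \<open>h\<close> of the two supports is attained only by the pair
  \<open>(v, h)\<close>.\<close>

lemma leading_coefficient:
  assumes a: "a \<in> carrier Dp" and y: "y \<in> carrier Dp"
    and v: "\<And>u. a u \<noteq> 0 \<Longrightarrow> v \<le> u" and h: "\<And>w. y w \<noteq> 0 \<Longrightarrow> h \<le> w"
  shows "(a \<otimes>\<^bsub>Dp\<^esub> y) (v + h) = a v * act p v (y h)"
    and "g < v + h \<Longrightarrow> (a \<otimes>\<^bsub>Dp\<^esub> y) g = 0"
proof -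
  have fib: "v + h \<le> g \<and> (g = v + h \<longrightarrow> (u, w) = (v, h))" if "(u, w) \<in> fibre (supp a) (supp y) g" for u w g
  proof -
    have uw: "u + w = g" "v \<le> u" "h \<le> w" using that v h by (auto simp: fibre_def supp_def)
    show ?thesis
    proof (cases "u = v \<and> w = h")
      case False
      hence "v + h < u + w" using uw add_less_le_mono add_le_less_mono by (metis order_le_imp_less_or_eq)
      thus ?thesis using uw by auto
    qed (use uw in auto)
  qed
  have "(a \<otimes>\<^bsub>Dp\<^esub> y) (v + h) = (\<Sum>(u, w)\<in>{(v, h)}. a u * act p u (y w))"
    unfolding D_mult_supp[OF a y]
    by (rule sum.mono_neutral_left) (use fib in \<open>fastforce simp: fibre_def supp_def\<close>)+
  thus "(a \<otimes>\<^bsub>Dp\<^esub> y) (v + h) = a v * act p v (y h)" by simp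
  show "(a \<otimes>\<^bsub>Dp\<^esub> y) g = 0" if "g < v + h"
  proof -
    have "fibre (supp a) (supp y) g = {}"
    proof (rule equals0I)
      fix q assume "q \<in> fibre (supp a) (supp y) g"
      hence "v + h \<le> g" using fib[of "fst q" "snd q" g] by simp
      thus False using that leD by blast
    qed
    thus ?thesis unfolding D_mult_supp[OF a y] by simp
  qed
qed

text \<open>Let \<open>v\<close> be the least exponent of \<open>a\<close>. The coefficient of \<open>a y\<close> at \<open>v + h\<close> depends on \<open>y\<close> only up to
  \<open>h\<close>, and on \<open>y h\<close> bijectively. Call \<open>y\<close> good if \<open>a y\<close> agrees with \<open>1\<close> at all \<open>g \<le> v + h\<close> for each
  \<open>h\<close> in the support of \<open>y\<close>. Two good series agree up to each exponent that both supports reach, so good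
  series are truncations of one another, and the union \<open>Y\<close> of all of them is good. If \<open>a Y\<close> differed
  from \<open>1\<close>, first at \<open>g\<close>, then adding a suitable term at \<open>g - v\<close> to \<open>Y\<close> would give a good series
  that is not a truncation of \<open>Y\<close>.\<close>

lemma right_inverse_exists:
  assumes a: "a \<in> carrier Dp" "a \<noteq> \<zero>\<^bsub>Dp\<^esub>"
  shows "\<exists>y\<in>carrier Dp. a \<otimes>\<^bsub>Dp\<^esub> y = \<one>\<^bsub>Dp\<^esub>"
proof -
  interpret ring Dp by (rule D_ring)
  have "supp a \<noteq> {}" using a(2) by (auto simp: supp_def D_zero)
  then obtain v where v: "a v \<noteq> 0" "\<And>u. a u \<noteq> 0 \<Longrightarrow> v \<le> u"
    using woD[OF D_wo[OF a(1)] order.refl] by (auto simp: supp_def)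
  define good where "good y \<longleftrightarrow> y \<in> carrier Dp \<and>
    (\<forall>h g. y h \<noteq> 0 \<longrightarrow> g \<le> v + h \<longrightarrow> (a \<otimes>\<^bsub>Dp\<^esub> y) g = \<one>\<^bsub>Dp\<^esub> g)" for y
  have goodD: "(a \<otimes>\<^bsub>Dp\<^esub> y) g = \<one>\<^bsub>Dp\<^esub> g" if "good y" "y h \<noteq> 0" "g \<le> v + h" for y h g
    using that unfolding good_def by blast
  have good_carrier: "y \<in> carrier Dp" if "good y" for y using that by (simp add: good_def)
  have mult_diff: "(a \<otimes>\<^bsub>Dp\<^esub> (\<lambda>g. y g - z g)) = (\<lambda>g. (a \<otimes>\<^bsub>Dp\<^esub> y) g - (a \<otimes>\<^bsub>Dp\<^esub> z) g)"
    if "y \<in> carrier Dp" "z \<in> carrier Dp" for y z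
  proof -
    have "a \<otimes>\<^bsub>Dp\<^esub> (y \<ominus>\<^bsub>Dp\<^esub> z) = a \<otimes>\<^bsub>Dp\<^esub> y \<ominus>\<^bsub>Dp\<^esub> a \<otimes>\<^bsub>Dp\<^esub> z"
      using that a by (simp add: minus_eq r_distr r_minus)
    thus ?thesis using that a by (simp add: D_minus)
  qed
  \<comment> \<open>The action of \<open>- v\<close> undoes that of \<open>v\<close>.\<close>
  have act_nonzero: "act p v c \<noteq> 0" if "c \<in> K_set p" "c \<noteq> 0" for c
    using act_act[OF that(1), of "- v" v] act_zero[OF that(1)] that(2) by auto
  \<comment> \<open>At the first difference \<open>h\<close> of two series, their products with \<open>a\<close> differ at \<open>v + h\<close>.\<close>
  have disagree: "(a \<otimes>\<^bsub>Dp\<^esub> y) (v + h) \<noteq> (a \<otimes>\<^bsub>Dp\<^esub> z) (v + h)"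
    if yz: "y \<in> carrier Dp" "z \<in> carrier Dp" and h: "y h \<noteq> z h" "\<And>w. w < h \<Longrightarrow> y w = z w" for y z h
  proof -
    have d: "(\<lambda>g. y g - z g) \<in> carrier Dp" using minus_closed[OF yz] by (simp add: D_minus yz)
    have "h \<le> w" if "y w - z w \<noteq> 0" for w using h(2)[of w] that by (cases "w < h") auto
    hence "(a \<otimes>\<^bsub>Dp\<^esub> (\<lambda>g. y g - z g)) (v + h) = a v * act p v (y h - z h)"
      using leading_coefficient(1)[OF a(1) d v(2), where h = h] by blast
    also have "\<dots> \<noteq> 0" using act_nonzero D_K[OF d, of h] h(1) v(1) by simp
    finally show ?thesis by (simp add: mult_diff[OF yz])
  qed
  have agree: "y w = z w" if y: "good y" and z: "good z" and w: "y w \<noteq> 0" "z w' \<noteq> 0" "w \<le> w'" for y z w w'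
  proof (rule ccontr)
    assume "y w \<noteq> z w"
    hence "{g. y g \<noteq> z g} \<noteq> {}" by blast
    moreover have "wo {g. y g \<noteq> z g}"
      by (rule wo_subset[OF wo_Un[OF D_wo[OF good_carrier[OF y]] D_wo[OF good_carrier[OF z]]]]) (auto simp: supp_def)
    ultimately obtain h where h: "y h \<noteq> z h" "\<And>g. y g \<noteq> z g \<Longrightarrow> h \<le> g"
      using woD[OF _ order.refl] by blast
    have "h \<le> w" using h(2) \<open>y w \<noteq> z w\<close> by blast
    hence "v + h \<le> v + w" "v + h \<le> v + w'" using w(3) by simp_all
    hence "(a \<otimes>\<^bsub>Dp\<^esub> y) (v + h) = (a \<otimes>\<^bsub>Dp\<^esub> z) (v + h)"
      using goodD[OF y w(1)] goodD[OF z w(2)] by simp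
    moreover have "y g = z g" if "g < h" for g using h(2)[of g] that by (meson leD)
    ultimately show False using disagree[OF good_carrier[OF y] good_carrier[OF z] h(1)] by blast
  qed
  have agree': "y w = z w" if y: "good y" and z: "good z" and w: "z w' \<noteq> 0" "y w'' \<noteq> 0" "w \<le> w'" "w \<le> w''" for y z w w' w''
    using agree[OF y z, of w w'] agree[OF z y, of w w''] w by metis
  define Y where "Y h = (if \<exists>y. good y \<and> y h \<noteq> 0 then (SOME y. good y \<and> y h \<noteq> 0) h else 0)" for h
  have Y_nonzero: "\<exists>y. good y \<and> y h \<noteq> 0" if "Y h \<noteq> 0" for h
  proof (rule ccontr)
    assume "\<not> (\<exists>y. good y \<and> y h \<noteq> 0)"
    hence "Y h = 0" unfolding Y_def by (rule if_not_P)
    thus False using that by simp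
  qed
  have Y_eq: "Y w = y w" if y: "good y" "y h \<noteq> 0" "w \<le> h" for y h w
  proof (cases "\<exists>z. good z \<and> z w \<noteq> 0")
    case True
    let ?z = "SOME z. good z \<and> z w \<noteq> 0"
    have z: "good ?z" "?z w \<noteq> 0" using someI_ex[OF True] by blast+
    have "?z w = y w" by (rule agree[OF z(1) y(1) z(2) y(2,3)])
    thus ?thesis using True by (simp add: Y_def)
  next
    case False
    thus ?thesis using y(1) by (auto simp: Y_def)
  qed
  have Y_carrier: "Y \<in> carrier Dp"
    unfolding D_carrier
  proof
    show "\<forall>h. Y h \<in> K_set p"
    proof
      fix h show "Y h \<in> K_set p"
      proof (cases "Y h = 0")
        case False
        then obtain y where "good y" "y h \<noteq> 0" using Y_nonzero by blast
        thus ?thesis using Y_eq[of y h h] D_K[OF good_carrier] by simp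
      qed (simp add: K_rat)
    qed
    \<comment> \<open>Below a point of its support, \<open>Y\<close> coincides with a single good series.\<close>
    show "wo (supp Y)" unfolding wo_def
    proof (intro allI impI)
      fix B assume B: "B \<subseteq> supp Y" "B \<noteq> {}"
      then obtain h where h: "h \<in> B" "Y h \<noteq> 0" by (auto simp: supp_def)
      then obtain y where y: "good y" "y h \<noteq> 0" using Y_nonzero by blast
      have "{w \<in> B. w \<le> h} \<subseteq> supp y" using Y_eq[OF y] B(1) by (auto simp: supp_def)
      then obtain m where m: "m \<in> B" "m \<le> h" "\<And>b. b \<in> B \<Longrightarrow> b \<le> h \<Longrightarrow> m \<le> b"
        using woD[OF D_wo[OF good_carrier[OF y(1)]], of "{w \<in> B. w \<le> h}"] h(1) by blast
      thus "\<exists>m\<in>B. \<forall>b\<in>B. m \<le> b" by (metis linear order_trans)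
    qed
  qed
  \<comment> \<open>The coefficient of \<open>a y\<close> at \<open>g\<close> only involves \<open>y w\<close> for \<open>w \<le> g - v\<close>.\<close>
  have mult_local: "(a \<otimes>\<^bsub>Dp\<^esub> y) g = (a \<otimes>\<^bsub>Dp\<^esub> z) g"
    if yz: "y \<in> carrier Dp" "z \<in> carrier Dp" and eq: "\<And>w. v + w \<le> g \<Longrightarrow> y w = z w" for y z g
  proof -
    let ?U = "supp y \<union> supp z"
    have U: "wo ?U" using yz D_wo wo_Un by blast
    note m = D_mult[OF D_wo[OF a(1)] U order.refl]
    have "(a \<otimes>\<^bsub>Dp\<^esub> y) g = (\<Sum>(u, w)\<in>fibre (supp a) ?U g. a u * act p u (y w))"
      by (rule m) simp
    also have "\<dots> = (\<Sum>(u, w)\<in>fibre (supp a) ?U g. a u * act p u (z w))"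
    proof (intro sum.cong refl, clarify)
      fix u w assume "(u, w) \<in> fibre (supp a) ?U g"
      hence "u + w = g" "v \<le> u" using v(2) by (auto simp: fibre_def supp_def)
      hence "y w = z w" by (intro eq) auto
      thus "a u * act p u (y w) = a u * act p u (z w)" by simp
    qed
    also have "\<dots> = (a \<otimes>\<^bsub>Dp\<^esub> z) g" by (rule m[symmetric]) simp
    finally show ?thesis .
  qed
  have Y_good: "good Y"
    unfolding good_def
  proof (intro conjI allI impI Y_carrier)
    fix h g assume h: "Y h \<noteq> 0" and g: "g \<le> v + h"
    obtain y where y: "good y" "y h \<noteq> 0" using Y_nonzero[OF h] by blast
    have "Y w = y w" if "v + w \<le> g" for w
      using Y_eq[OF y, of w] order_trans[OF that g] by simp
    hence "(a \<otimes>\<^bsub>Dp\<^esub> Y) g = (a \<otimes>\<^bsub>Dp\<^esub> y) g" by (intro mult_local Y_carrier good_carrier y(1))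
    thus "(a \<otimes>\<^bsub>Dp\<^esub> Y) g = \<one>\<^bsub>Dp\<^esub> g" using goodD[OF y g] by simp
  qed
  have "a \<otimes>\<^bsub>Dp\<^esub> Y = \<one>\<^bsub>Dp\<^esub>"
  proof (rule ccontr)
    assume ne: "a \<otimes>\<^bsub>Dp\<^esub> Y \<noteq> \<one>\<^bsub>Dp\<^esub>"
    let ?E = "{g. (a \<otimes>\<^bsub>Dp\<^esub> Y) g \<noteq> \<one>\<^bsub>Dp\<^esub> g}"
    have aY: "a \<otimes>\<^bsub>Dp\<^esub> Y \<in> carrier Dp" using a Y_carrier by simp
    have "wo ?E"
      by (rule wo_subset[OF wo_Un[OF D_wo[OF aY] D_wo[OF one_closed]]]) (auto simp: supp_def)
    moreover have "?E \<noteq> {}" using ne by auto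
    ultimately obtain g where g: "(a \<otimes>\<^bsub>Dp\<^esub> Y) g \<noteq> \<one>\<^bsub>Dp\<^esub> g" "\<And>b. (a \<otimes>\<^bsub>Dp\<^esub> Y) b \<noteq> \<one>\<^bsub>Dp\<^esub> b \<Longrightarrow> g \<le> b"
      using woD[OF _ order.refl, of ?E] by auto
    define h where "h = g - v"
    have vh: "v + h = g" by (simp add: h_def)
    have beyond: "w < h" if "Y w \<noteq> 0" for w
    proof (rule ccontr)
      assume "\<not> w < h"
      hence "g \<le> v + w" by (simp flip: vh)
      thus False using goodD[OF Y_good that] g(1) by blast
    qed
    define e where "e = \<one>\<^bsub>Dp\<^esub> g - (a \<otimes>\<^bsub>Dp\<^esub> Y) g"
    have eK: "e \<in> K_set p"
      using K_add[OF D_K[OF one_closed] K_uminus[OF D_K[OF aY]]] by (simp add: e_def)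
    have e0: "e \<noteq> 0" using g(1) by (simp add: e_def)
    \<comment> \<open>The coefficient that makes the new leading term \<open>a\<^sub>v c\<^sup>v\<close> equal to the missing value \<open>e\<close>.\<close>
    define c where "c = act p (- v) (inverse (a v) * e)"
    have avK: "inverse (a v) * e \<in> K_set p" by (intro K_mult K_inverse D_K a eK)
    have cK: "c \<in> K_set p" unfolding c_def by (rule act_closed[OF avK])
    have ace: "a v * act p v c = e"
      unfolding c_def using act_act[OF avK, of v "- v"] act_zero[OF avK] v(1) by simp
    define Y' where "Y' = (\<lambda>w. Y w + hahn_monom c h w)"
    have mc: "hahn_monom c h \<in> carrier Dp" by (rule hahn_monom_closed[OF cK])
    have Y'_sum: "Y' = Y \<oplus>\<^bsub>Dp\<^esub> hahn_monom c h" by (simp add: Y'_def D_add)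
    have Y'_carrier: "Y' \<in> carrier Dp" unfolding Y'_sum using Y_carrier mc by simp
    have aY': "(a \<otimes>\<^bsub>Dp\<^esub> Y') b = (a \<otimes>\<^bsub>Dp\<^esub> Y) b + (a \<otimes>\<^bsub>Dp\<^esub> hahn_monom c h) b" for b
      unfolding Y'_sum using fun_cong[OF r_distr[OF Y_carrier mc a(1)], of b] by (simp add: D_add)
    have mon: "h \<le> w" if "hahn_monom c h w \<noteq> 0" for w using that by (simp add: hahn_monom_def split: if_splits)
    note lead = leading_coefficient[OF a(1) mc v(2) mon]
    have solved: "(a \<otimes>\<^bsub>Dp\<^esub> Y') b = \<one>\<^bsub>Dp\<^esub> b" if "b \<le> g" for b
    proof (cases "b = g")
      case True
      have "(a \<otimes>\<^bsub>Dp\<^esub> hahn_monom c h) g = e"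
        using lead(1) ace by (simp add: vh hahn_monom_def)
      thus ?thesis using True aY'[of g] by (simp add: e_def)
    next
      case False
      hence "b < g" using that by simp
      hence "(a \<otimes>\<^bsub>Dp\<^esub> hahn_monom c h) b = 0" using lead(2)[of b] vh by blast
      moreover have "(a \<otimes>\<^bsub>Dp\<^esub> Y) b = \<one>\<^bsub>Dp\<^esub> b" using g(2)[of b] \<open>b < g\<close> by (meson leD)
      ultimately show ?thesis using aY'[of b] by simp
    qed
    have "w \<le> h" if "Y' w \<noteq> 0" for w
      using that beyond[of w] mon[of w] by (cases "Y w = 0") (auto simp: Y'_def hahn_monom_def split: if_splits)
    hence "b \<le> g" if "Y' w \<noteq> 0" "b \<le> v + w" for b w
      using that vh by (metis add_left_mono order_trans)
    hence "good Y'" unfolding good_def using Y'_carrier solved by blast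
    \<comment> \<open>Every good series is a truncation of \<open>Y\<close>, but \<open>h\<close> is in the support of \<open>Y'\<close> only.\<close>
    moreover have Yh: "Y h = 0" using beyond by blast
    moreover have "c \<noteq> 0" using ace e0 by auto
    hence "Y' h \<noteq> 0" using Yh by (simp add: Y'_def hahn_monom_def)
    ultimately show False using Y_eq[of Y' h h] by simp
  qed
  thus ?thesis using Y_carrier by blast
qed

text \<open>In a ring where each nonzero element has a right inverse, the right inverses are two-sided.\<close>

lemma D_skewfield: "skewfield Dp"
proof -
  interpret ring Dp by (rule D_ring)
  have ne: "\<one>\<^bsub>Dp\<^esub> \<noteq> \<zero>\<^bsub>Dp\<^esub>"
    by (auto simp: D_one D_zero const_def fun_eq_iff)
  have "a \<in> Units Dp" if a: "a \<in> carrier Dp" "a \<noteq> \<zero>\<^bsub>Dp\<^esub>" for a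
  proof -
    obtain y where y: "y \<in> carrier Dp" "a \<otimes>\<^bsub>Dp\<^esub> y = \<one>\<^bsub>Dp\<^esub>" using right_inverse_exists[OF a] by blast
    hence "y \<noteq> \<zero>\<^bsub>Dp\<^esub>" using a ne by auto
    then obtain z where z: "z \<in> carrier Dp" "y \<otimes>\<^bsub>Dp\<^esub> z = \<one>\<^bsub>Dp\<^esub>" using right_inverse_exists y by blast
    have "a = a \<otimes>\<^bsub>Dp\<^esub> (y \<otimes>\<^bsub>Dp\<^esub> z)" using a z by simp
    also have "\<dots> = (a \<otimes>\<^bsub>Dp\<^esub> y) \<otimes>\<^bsub>Dp\<^esub> z" using m_assoc[OF a(1) y(1) z(1)] by simp
    also have "\<dots> = z" unfolding y(2) using z(1) by simp
    finally show ?thesis using a y z by (auto simp: Units_def)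
  qed
  moreover have "\<zero>\<^bsub>Dp\<^esub> \<notin> Units Dp" using ne by (auto simp: Units_def)
  ultimately have "Units Dp = carrier Dp - {\<zero>\<^bsub>Dp\<^esub>}" by (auto simp: Units_def)
  thus ?thesis using ne by unfold_locales auto
qed

end

section \<open>The quaternion pairs in the series ring\<close>

context sqrt_tower
begin

definition root :: "nat \<Rightarrow> G \<Rightarrow> real" where "root i = const (rt i)"
definition xinv :: "nat \<Rightarrow> G \<Rightarrow> real" where "xinv i = hahn_monom 1 (- Poly_Mapping.single i 1)"

lemma root_hahn_monom: "root i = hahn_monom (rt i) 0"
  by (simp add: root_def const_eq_hahn_monom)

lemma root_closed: "root i \<in> carrier Dp" and xinv_closed: "xinv i \<in> carrier Dp"
  by (auto simp: root_hahn_monom xinv_def intro!: hahn_monom_closed K_rt K_rat)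

lemma mult_root_left: "y \<in> carrier Dp \<Longrightarrow> (root i \<otimes>\<^bsub>Dp\<^esub> y) h = rt i * y h"
  by (simp add: root_hahn_monom hahn_monom_mult_left act_zero D_K)

lemma mult_root_right: "y \<in> carrier Dp \<Longrightarrow> (y \<otimes>\<^bsub>Dp\<^esub> root i) h = y h * (sgn_of h i * rt i)"
  by (simp add: root_hahn_monom hahn_monom_mult_right act_rt)

lemma mult_xinv_left: "y \<in> carrier Dp \<Longrightarrow> (xinv i \<otimes>\<^bsub>Dp\<^esub> y) h
    = act p (- Poly_Mapping.single i 1) (y (h + Poly_Mapping.single i 1))"
  by (simp add: xinv_def hahn_monom_mult_left)

lemma mult_xinv_right: "y \<in> carrier Dp \<Longrightarrow> (y \<otimes>\<^bsub>Dp\<^esub> xinv i) h = y (h + Poly_Mapping.single i 1)"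
  by (simp add: xinv_def hahn_monom_mult_right)

text \<open>The hypotheses say that the action is trivial on the coefficients that meet in the product, so the
  multiplication is that of the untwisted, commutative series ring.\<close>

lemma rational_products_commute:
  assumes a: "a \<in> carrier Dp" and b: "b \<in> carrier Dp"
    and fixed: "\<And>u v. a u \<noteq> 0 \<Longrightarrow> act p u (b v) = b v" "\<And>u v. b v \<noteq> 0 \<Longrightarrow> act p v (a u) = a u"
  shows "a \<otimes>\<^bsub>Dp\<^esub> b = b \<otimes>\<^bsub>Dp\<^esub> a"
proof
  fix g
  have "(a \<otimes>\<^bsub>Dp\<^esub> b) g = (\<Sum>(u, v)\<in>fibre (supp a) (supp b) g. a u * b v)"
    unfolding D_mult_supp[OF a b]
    by (intro sum.cong refl) (auto simp: fibre_def supp_def fixed(1))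
  also have "\<dots> = (\<Sum>(v, u)\<in>fibre (supp b) (supp a) g. b v * a u)"
    by (rule sum.reindex_bij_witness[where i = prod.swap and j = prod.swap])
       (auto simp: fibre_def add.commute)
  also have "\<dots> = (b \<otimes>\<^bsub>Dp\<^esub> a) g"
    unfolding D_mult_supp[OF b a]
    by (intro sum.cong refl) (auto simp: fibre_def supp_def fixed(2))
  finally show "(a \<otimes>\<^bsub>Dp\<^esub> b) g = (b \<otimes>\<^bsub>Dp\<^esub> a) g" .
qed

text \<open>Commuting with \<open>x\<^sub>i\<^sup>-\<^sup>1\<close> means that the coefficients are fixed by the sign change at \<open>i\<close>.\<close>

lemma rational_if_commutes_with_xinv:
  assumes "a \<in> centralizer Dp (range xinv)"
  shows "a g \<in> \<rat>"
proof (rule act_fixed_rational)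
  have a: "a \<in> carrier Dp" and c: "a \<otimes>\<^bsub>Dp\<^esub> xinv i = xinv i \<otimes>\<^bsub>Dp\<^esub> a" for i
    using assms by (auto simp: in_centralizer)
  show "a g \<in> K_set p" by (rule D_K[OF a])
  show "act p (- Poly_Mapping.single i 1) (a g) = a g" for i
    using fun_cong[OF c[of i], of "g - Poly_Mapping.single i 1"]
    by (simp add: mult_xinv_left[OF a] mult_xinv_right[OF a])
qed

lemma alpha_eq: "alpha g = (if g \<in> range (\<lambda>i. - Poly_Mapping.single i 1) then 1 else 0)"
  by (auto simp: alpha_def)

lemma neg_single_less:
  assumes "i < j"
  shows "- Poly_Mapping.single i (1 :: int) < - Poly_Mapping.single j 1"
proof -
  have "less_fun (Poly_Mapping.lookup (- Poly_Mapping.single i (1 :: int))) (Poly_Mapping.lookup (- Poly_Mapping.single j 1))"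
    unfolding less_fun_def using assms
    by (intro exI[of _ i]) (auto simp: lookup_single when_def)
  thus ?thesis by (simp add: less_poly_mapping.rep_eq)
qed

lemma alpha_closed: "alpha \<in> carrier Dp"
proof (rule D_carrierI)
  show "alpha g \<in> K_set p" for g by (simp add: alpha_eq K_rat)
  let ?f = "\<lambda>i. - Poly_Mapping.single i (1 :: int) :: G"
  show "wo (range ?f)" unfolding wo_def
  proof (intro allI impI)
    fix B assume B: "B \<subseteq> range ?f" "B \<noteq> {}"
    define m where "m = (LEAST i. ?f i \<in> B)"
    have "\<exists>i. ?f i \<in> B" using B by blast
    hence "?f m \<in> B" unfolding m_def by (rule LeastI_ex)
    moreover have "?f m \<le> b" if b: "b \<in> B" for b
    proof -
      obtain j where j: "b = ?f j" using subsetD[OF B(1) b] by (rule rangeE)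
      hence "m \<le> j" using b unfolding m_def by (auto intro: Least_le)
      thus ?thesis using neg_single_less[of m j] j by (cases "m = j") auto
    qed
    ultimately show "\<exists>m\<in>B. \<forall>b\<in>B. m \<le> b" by blast
  qed
  show "g \<in> range ?f" if "alpha g \<noteq> 0" for g using that by (simp add: alpha_eq split: if_splits)
qed

lemma xinv_apply: "xinv i g = (if g = - Poly_Mapping.single i 1 then 1 else 0)"
  by (simp add: xinv_def hahn_monom_def)

text \<open>A series that commutes with all \<open>\<surd>p\<^sub>i\<close> is supported on group elements that act trivially on \<open>K\<close>; if
  its coefficients are rational in addition, it is central.\<close>

lemma quaternion_tower_D: "quaternion_tower Dp root xinv alpha"
proof -
  interpret skewfield Dp by (rule D_skewfield)
  have xinv_mult: "(xinv i \<otimes>\<^bsub>Dp\<^esub> xinv j) h = (if h + Poly_Mapping.single i 1 + Poly_Mapping.single j 1 = 0 then 1 else 0)" for i j h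
    by (simp add: mult_xinv_left xinv_closed xinv_apply eq_neg_iff_add_eq_0)
  show ?thesis
  proof
    fix i j
    show "root i \<in> carrier Dp" "xinv i \<in> carrier Dp" "alpha \<in> carrier Dp"
      by (rule root_closed xinv_closed alpha_closed)+
    have "root i 0 \<noteq> \<zero>\<^bsub>Dp\<^esub> 0" using rt_pos[of i] by (simp add: root_def const_def D_zero)
    thus "root i \<noteq> \<zero>\<^bsub>Dp\<^esub>" by metis
    have "xinv i (- Poly_Mapping.single i 1) \<noteq> \<zero>\<^bsub>Dp\<^esub> (- Poly_Mapping.single i 1)" by (simp add: xinv_apply D_zero)
    thus "xinv i \<noteq> \<zero>\<^bsub>Dp\<^esub>" by metis
    show "root i \<otimes>\<^bsub>Dp\<^esub> root j = root j \<otimes>\<^bsub>Dp\<^esub> root i"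
      by (rule ext) (simp add: mult_root_left root_closed, simp add: root_def const_def)
    show "xinv i \<otimes>\<^bsub>Dp\<^esub> xinv j = xinv j \<otimes>\<^bsub>Dp\<^esub> xinv i"
      by (rule ext) (simp add: xinv_mult add.assoc add.left_commute add.commute)
    show "root i \<otimes>\<^bsub>Dp\<^esub> xinv j = xinv j \<otimes>\<^bsub>Dp\<^esub> root i" if "i \<noteq> j"
      by (rule ext) (use that in \<open>simp add: mult_root_left mult_root_right xinv_closed xinv_apply sgn_of_neg_single\<close>)
    show "root i \<otimes>\<^bsub>Dp\<^esub> xinv i \<oplus>\<^bsub>Dp\<^esub> xinv i \<otimes>\<^bsub>Dp\<^esub> root i = \<zero>\<^bsub>Dp\<^esub>"
      by (simp add: D_add D_zero mult_root_left mult_root_right xinv_closed xinv_apply sgn_of_neg_single fun_eq_iff)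
    have "(\<one>\<^bsub>Dp\<^esub> \<oplus>\<^bsub>Dp\<^esub> \<one>\<^bsub>Dp\<^esub>) 0 \<noteq> \<zero>\<^bsub>Dp\<^esub> 0" by (simp add: D_one D_add D_zero const_def)
    thus "\<one>\<^bsub>Dp\<^esub> \<oplus>\<^bsub>Dp\<^esub> \<one>\<^bsub>Dp\<^esub> \<noteq> \<zero>\<^bsub>Dp\<^esub>" by metis
    show "alpha \<otimes>\<^bsub>Dp\<^esub> xinv i = xinv i \<otimes>\<^bsub>Dp\<^esub> alpha"
      by (rule rational_products_commute[OF alpha_closed xinv_closed]) (simp_all add: alpha_eq xinv_apply act_rat)
    show "alpha \<otimes>\<^bsub>Dp\<^esub> root i = root i \<otimes>\<^bsub>Dp\<^esub> (alpha \<ominus>\<^bsub>Dp\<^esub> (xinv i \<oplus>\<^bsub>Dp\<^esub> xinv i))"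
    proof
      fix h
      have tt: "xinv i \<oplus>\<^bsub>Dp\<^esub> xinv i \<in> carrier Dp" using xinv_closed by simp
      have "alpha \<ominus>\<^bsub>Dp\<^esub> (xinv i \<oplus>\<^bsub>Dp\<^esub> xinv i) \<in> carrier Dp" using alpha_closed tt by simp
      hence "(root i \<otimes>\<^bsub>Dp\<^esub> (alpha \<ominus>\<^bsub>Dp\<^esub> (xinv i \<oplus>\<^bsub>Dp\<^esub> xinv i))) h = rt i * (alpha h - (xinv i h + xinv i h))"
        by (simp only: mult_root_left D_minus[OF alpha_closed tt]) (simp add: D_add)
      moreover have "alpha h * sgn_of h i = alpha h - (xinv i h + xinv i h)"
      proof (cases "h \<in> range (\<lambda>j. - Poly_Mapping.single j 1 :: G)")
        case True
        then obtain j where j: "h = - Poly_Mapping.single j 1" by blast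
        have "xinv i h = (if i = j then 1 else 0)"
          using neg_single_less[of i j] neg_single_less[of j i] by (cases i j rule: linorder_cases) (auto simp: xinv_apply j)
        moreover have "alpha h = 1" using True by (simp add: alpha_eq)
        ultimately show ?thesis unfolding j sgn_of_neg_single by auto
      next
        case False
        hence "alpha h = 0" "xinv i h = 0" by (auto simp: alpha_eq xinv_apply)
        thus ?thesis by simp
      qed
      ultimately show "(alpha \<otimes>\<^bsub>Dp\<^esub> root i) h = (root i \<otimes>\<^bsub>Dp\<^esub> (alpha \<ominus>\<^bsub>Dp\<^esub> (xinv i \<oplus>\<^bsub>Dp\<^esub> xinv i))) h"
        by (simp add: mult_root_right[OF alpha_closed] mult.assoc[symmetric])
    qed
  next
    fix c d assume "c \<in> centralizer Dp (range xinv)" "d \<in> centralizer Dp (range xinv)"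
    moreover from this have "c \<in> carrier Dp" "d \<in> carrier Dp" by (simp_all add: in_centralizer)
    ultimately show "c \<otimes>\<^bsub>Dp\<^esub> d = d \<otimes>\<^bsub>Dp\<^esub> c"
      using rational_if_commutes_with_xinv by (intro rational_products_commute act_rat) auto
  next
    show "centralizer Dp (range root \<union> range xinv) \<subseteq> center Dp"
    proof
      fix z assume z: "z \<in> centralizer Dp (range root \<union> range xinv)"
      hence zc: "z \<in> carrier Dp" and zS: "\<And>i. z \<otimes>\<^bsub>Dp\<^esub> root i = root i \<otimes>\<^bsub>Dp\<^esub> z"
        and "z \<in> centralizer Dp (range xinv)" by (auto simp: in_centralizer)
      hence rat: "z g \<in> \<rat>" for g using rational_if_commutes_with_xinv by blast
      have triv: "act p g c = c" if "z g \<noteq> 0" "c \<in> K_set p" for g c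
      proof (rule act_trivial[OF that(2)])
        show "act p g (rt i) = rt i" for i
          using fun_cong[OF zS[of i], of g] that(1) by (simp add: act_rt mult_root_left[OF zc] mult_root_right[OF zc])
      qed
      have "z \<otimes>\<^bsub>Dp\<^esub> y = y \<otimes>\<^bsub>Dp\<^esub> z" if y: "y \<in> carrier Dp" for y
        by (rule rational_products_commute[OF zc y]) (simp_all add: triv D_K[OF y] act_rat[OF rat])
      thus "z \<in> center Dp" using zc by (simp add: center_def)
    qed
  next
    show "inj xinv"
    proof (rule injI)
      fix i j assume "xinv i = xinv j"
      hence "xinv i (- Poly_Mapping.single i 1) = xinv j (- Poly_Mapping.single i 1)" by simp
      hence "- Poly_Mapping.single i (1::int) = - Poly_Mapping.single j 1" by (simp add: xinv_apply split: if_splits)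
      thus "i = j" using neg_single_less[of i j] neg_single_less[of j i] by (cases i j rule: linorder_cases) auto
    qed
  qed
qed

end

theorem theorem4p5:
  fixes p :: "nat \<Rightarrow> nat"
  assumes "\<And>i. Factorial_Ring.prime (p i)"
    and "strict_mono p"
  shows "skewfield (D_alpha p) \<and>
    \<not> algebraic_skewfield (D_alpha p) \<and>
    (\<forall>x \<in> carrier (D_alpha p) - center (D_alpha p). kurosh (D_alpha p) x)"
proof -
  interpret sqrt_tower p by unfold_locales (use assms in auto)
  interpret Q: quaternion_tower "D p" root xinv alpha by (rule quaternion_tower_D)
  have "D_alpha p = (D p)\<lparr>carrier := Q.\<Delta>\<rparr>"
    unfolding D_alpha_def Q.\<Delta>_def by (simp add: root_def[abs_def])
  thus ?thesis using Q.generated_tower by simp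
qed


end
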